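(* Let $P_D[X_D|\Theta_D]$ be a projective limit model, i.e. the projective limit of a projective family $\langle P_I[X_I|\Theta_I]\rangle_{I\in D}$ of parametrized models. For each $I\in D$, let $\mathcal{S}_I\subset\mathcal{A}$ be a sufficient $\sigma$-algebra for $P_I[X_I|\Theta_I]$. (1) If $\langle\mathcal{S}_I\rangle_{I\in D}$ is directed (that is, $\mathcal{S}_I\subset\mathcal{S}_J$ whenever $I\preceq J$), then $\mathcal{S}_D:=\sigma(\mathcal{S}_I;I\in D)$ is sufficient for $P_D[X_D|\Theta_D]$. (2) Let $\langle\mathcal{U}_I,\mathcal{B}(\mathcal{U}_I),h_{JI}\rangle_{I\preceq J\in D}$ be a projective system of measurable (Polish) spaces and $S_I:\mathcal{X}_I\to\mathcal{U}_I$ projective measurable mappings, i.e. $h_{JI}\circ S_J=S_I\circ f_{JI}$ for $I\preceq J$. If each $S_I$ is a sufficient statistic for $P_I[X_I|\Theta_I]$, then a sufficient statistic for $P_D[X_D|\Theta_D]$ is given by the projective limit mapping $S_D:=\varprojlim\langle S_I\rangle_{I\in D}$. (3) Conversely, if any $\sigma$-algebra $\mathcal{C}\subset\mathcal{A}$ is sufficient for a projective limit model $P_D[X_D|\Theta_D]$, it is sufficient for all marginals $P_I[X_I|\Theta_I]$, $I\in D$.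
   Context: $(\Omega,\mathcal{A},\mathbb{P})$ is an abstract probability space, the common domain of all random variables. Projective system: $(D,\preceq)$ is a countable directed partially ordered set; the $\mathcal{X}_I$ are Polish spaces with Borel $\sigma$-algebras $\mathcal{B}_I$; $f_{JI}:\mathcal{X}_J\to\mathcal{X}_I$ ($I\preceq J$) are continuous with $f_{II}=\mathrm{Id}$ and $f_{KI}=f_{JI}\circ f_{KJ}$ for $I\preceq J\preceq K$. The projective limit $\mathcal{X}_D$ is the set of all $(x_I)\in\prod_I\mathcal{X}_I$ with $x_I=f_{JI}x_J$ for $I\preceq J$, with canonical maps $f_I:(x_J)_J\mapsto x_I$ and the $\sigma$-algebra $\mathcal{B}_D=\sigma(f_I;I\in D)$. For projective mappings $S_I$, $S_D:\mathcal{X}_D\to\mathcal{U}_D$ is the unique map into the projective limit $\mathcal{U}_D$ of the $\mathcal{U}_I$ with $h_I\circ S_D=S_I\circ f_I$ for all $I$ ($h_I$ the canonical maps). Parametrized model: $P[X|\Theta]$ is the regular conditional probability of an observation variable $X:\Omega\to\mathcal{X}$ given a parameter variable $\Theta:\Omega\to\mathcal{T}$, where $X$ is the generic element of an exchangeable sequence $X^\infty$, and $\Theta=\Psi\circ F\circ X^{\infty}$ with $F$ the map to probability measures on $\mathcal{X}$ induced by the limiting empirical measure and $\Psi$ a bimeasurable map from the image $(F\circ X^\infty)(\Omega)$ onto a measurable space $\mathcal{T}$. Projective limit model: the observation spaces form a projective system $\langle\mathcal{X}_I,\mathcal{B}_I,f_{JI}\rangle_{I\preceq J\in D}$ of Polish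 spaces $\mathcal{X}_I$ with Borel $\sigma$-algebras $\mathcal{B}_I$, indexed by the countable directed set $D$, with continuous maps $f_{JI}:\mathcal{X}_J\to\mathcal{X}_I$ satisfying $f_{II}=\mathrm{Id}$ and $f_{KI}=f_{JI}\circ f_{KJ}$ for $I\preceq J\preceq K$, and the parameter spaces a projective system $\langle\mathcal{T}_I,\mathcal{B}(\mathcal{T}_I),g_{JI}\rangle$; the variables satisfy $X_I=f_{JI}X_J$, $\Theta_I=g_{JI}\Theta_J$; and the kernels $P_I[\,\cdot\,|\Theta_I]$ are projective, i.e. $P_J[f_{JI}^{-1}\,\cdot\,|\Theta_J]=P_I[\,\cdot\,|\Theta_I]$ $\mathbb{P}$-a.e. for $I\preceq J$. $X_D$, $\Theta_D$ are the projective limit variables ($f_IX_D=X_I$, $g_I\Theta_D=\Theta_I$), $\sigma(\Theta_D)=\sigma(\Theta_I;I\in D)$, and $P_D[\,\cdot\,|\Theta_D]$ is the unique (up to equivalence) $\sigma(\Theta_D)$-measurable kernel with $P_D[f_I^{-1}\,\cdot\,|\Theta_D]=P_I[\,\cdot\,|\Theta_I]$ a.e. for all $I$; the $P_I[X_I|\Theta_I]$ are its marginals. Sufficiency: a $\sigma$-algebra $\mathcal{S}\subset\mathcal{A}$ is sufficient for $P[X|\Theta]$ if there is a probability kernel $k:\mathcal{A}\times\Omega\to[0,1]$ such that for all $B\in\mathcal{B}(\mathcal{X})$: $\omega\mapsto k(X^{-1}B,\omega)$ is $\mathcal{S}$-measurable, and $P[B|\Theta,\mathcal{S}](\omega)=k(X^{-1}B,\omega)$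 $\mathbb{P}$-a.s. A measurable map $S:\mathcal{X}\to\mathcal{U}$ into a Polish measurable space is a sufficient statistic for $P[X|\Theta]$ if the $\sigma$-algebra $\sigma(S\circ X)$ is sufficient.
   Formalization: Literally, (1) and (2) fail on some abstract Ω. They are proved for every Ω with the sufficiency kernel taken as a probability kernel on the observation space, and with the kernel on 𝒜 when Ω is standard Borel; (3) is proved for both notions on every Ω. *)

theory Defs
  imports "HOL-Probability.Probability" "HOL-Combinatorics.Permutations"
begin

section \<open>Polish spaces and projective systems\<close>

text \<open>A countable family of Polish spaces is a family of topologies \<open>T I\<close> on subsets of one
  type \<open>'x\<close>. Since \<open>'x\<close> is an arbitrary type and \<open>T\<close> depends on the index,
  the spaces are unrelated to each other.\<close>

definition polish :: "'x topology \<Rightarrow> bool" where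
  "polish T \<longleftrightarrow> completely_metrizable_space T \<and> second_countable T"

definition borel_of :: "'x topology \<Rightarrow> 'x measure" where
  "borel_of T = sigma (topspace T) {U. openin T U}"

text \<open>A Polish measurable space: a measurable space whose \<open>\<sigma>\<close>-algebra is generated by some
  Polish topology on its carrier.\<close>

definition standard_borel :: "'x measure \<Rightarrow> bool" where
  "standard_borel N \<longleftrightarrow>
     (\<exists>T. polish T \<and> topspace T = space N \<and> sets (borel_of T) = sets N)"

text \<open>An index set is a carrier \<open>D\<close> with an order relation \<open>r\<close>, where \<open>(I, J) \<in> r\<close> means that
  \<open>I\<close> precedes \<open>J\<close>; note that \<open>partial_order_on D r\<close> includes \<open>r \<subseteq> D \<times> D\<close>.\<close>

definition countable_directed :: "'i set \<Rightarrow> 'i rel \<Rightarrow> bool" where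
  "countable_directed D r \<longleftrightarrow>
     countable D \<and> D \<noteq> {} \<and> partial_order_on D r \<and>
     (\<forall>I\<in>D. \<forall>J\<in>D. \<exists>K\<in>D. (I, K) \<in> r \<and> (J, K) \<in> r)"

text \<open>The map \<open>f J I\<close> goes from the larger index \<open>J\<close> to the smaller index \<open>I\<close>.\<close>

definition projective_system ::
    "'i set \<Rightarrow> 'i rel \<Rightarrow> ('i \<Rightarrow> 'x topology) \<Rightarrow> ('i \<Rightarrow> 'i \<Rightarrow> 'x \<Rightarrow> 'x) \<Rightarrow> bool" where
  "projective_system D r T f \<longleftrightarrow>
     countable_directed D r \<and>
     (\<forall>I\<in>D. polish (T I)) \<and>
     (\<forall>I J. (I, J) \<in> r \<longrightarrow> continuous_map (T J) (T I) (f J I)) \<and>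
     (\<forall>I\<in>D. \<forall>x\<in>topspace (T I). f I I x = x) \<and>
     (\<forall>I J K. (I, J) \<in> r \<and> (J, K) \<in> r \<longrightarrow>
        (\<forall>x\<in>topspace (T K). f K I x = f J I (f K J x)))"

text \<open>The canonical map onto the coordinate \<open>I\<close> is \<open>\<lambda>x. x I\<close>.\<close>

definition proj_lim_set ::
    "'i set \<Rightarrow> 'i rel \<Rightarrow> ('i \<Rightarrow> 'x topology) \<Rightarrow> ('i \<Rightarrow> 'i \<Rightarrow> 'x \<Rightarrow> 'x) \<Rightarrow> ('i \<Rightarrow> 'x) set" where
  "proj_lim_set D r T f =
     {x \<in> (\<Pi>\<^sub>E I\<in>D. topspace (T I)). \<forall>I J. (I, J) \<in> r \<longrightarrow> x I = f J I (x J)}"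

definition proj_lim ::
    "'i set \<Rightarrow> 'i rel \<Rightarrow> ('i \<Rightarrow> 'x topology) \<Rightarrow> ('i \<Rightarrow> 'i \<Rightarrow> 'x \<Rightarrow> 'x) \<Rightarrow> ('i \<Rightarrow> 'x) measure" where
  "proj_lim D r T f =
     sigma (proj_lim_set D r T f)
       (\<Union>I\<in>D. {(\<lambda>x. x I) -` B \<inter> proj_lim_set D r T f | B. B \<in> sets (borel_of (T I))})"

text \<open>The unique map \<open>Y\<close> into the projective limit with \<open>Y \<omega> I = X I \<omega>\<close>.\<close>

definition lim_var :: "'i set \<Rightarrow> ('i \<Rightarrow> 'w \<Rightarrow> 'x) \<Rightarrow> 'w \<Rightarrow> 'i \<Rightarrow> 'x" where
  "lim_var D X \<omega> = (\<lambda>I\<in>D. X I \<omega>)"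

text \<open>The unique map \<open>S\<^sub>D\<close> between the projective limits with \<open>S\<^sub>D x I = S I (x I)\<close>.\<close>

definition lim_map :: "'i set \<Rightarrow> ('i \<Rightarrow> 'x \<Rightarrow> 'u) \<Rightarrow> ('i \<Rightarrow> 'x) \<Rightarrow> 'i \<Rightarrow> 'u" where
  "lim_map D S x = (\<lambda>I\<in>D. S I (x I))"

section \<open>Parametrized models\<close>

definition cond_prob :: "'w measure \<Rightarrow> 'w measure \<Rightarrow> 'w set \<Rightarrow> 'w \<Rightarrow> real" where
  "cond_prob M G A = real_cond_exp M G (indicator A)"

definition exchangeable :: "'w measure \<Rightarrow> 'x measure \<Rightarrow> (nat \<Rightarrow> 'w \<Rightarrow> 'x) \<Rightarrow> bool" where
  "exchangeable M Y Xs \<longleftrightarrow>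
     (\<forall>n. Xs n \<in> M \<rightarrow>\<^sub>M Y) \<and>
     (\<forall>n \<pi>. \<pi> permutes {..<n} \<longrightarrow>
        distr M (\<Pi>\<^sub>M i\<in>UNIV. Y) (\<lambda>\<omega> i. Xs (\<pi> i) \<omega>) =
        distr M (\<Pi>\<^sub>M i\<in>UNIV. Y) (\<lambda>\<omega> i. Xs i \<omega>))"

text \<open>Weak convergence along \<open>sequentially\<close>; the library has it only for measures on the reals.\<close>

definition weakly_converges ::
    "'x topology \<Rightarrow> (nat \<Rightarrow> 'x measure) \<Rightarrow> 'x measure \<Rightarrow> bool" where
  "weakly_converges T \<mu> \<nu> \<longleftrightarrow>
     (\<forall>\<phi>. continuous_map T euclideanreal \<phi> \<and> bounded (\<phi> ` topspace T) \<longrightarrow>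
        (\<lambda>n. \<integral>x. \<phi> x \<partial>\<mu> n) \<longlonglongrightarrow> (\<integral>x. \<phi> x \<partial>\<nu>))"

definition empirical_measure :: "'x measure \<Rightarrow> (nat \<Rightarrow> 'x) \<Rightarrow> nat \<Rightarrow> 'x measure" where
  "empirical_measure Y x n = distr (uniform_count_measure {..n}) Y x"

text \<open>A measurable map from \<open>N\<close> onto \<open>L\<close> that also sends measurable sets to measurable sets.
  For an injective map this says that the inverse is measurable, but injectivity is not
  required.\<close>

definition bimeasurable_onto :: "'a measure \<Rightarrow> 'b measure \<Rightarrow> ('a \<Rightarrow> 'b) \<Rightarrow> bool" where
  "bimeasurable_onto N L \<psi> \<longleftrightarrow>
     \<psi> \<in> N \<rightarrow>\<^sub>M L \<and> \<psi> ` space N = space L \<and> (\<forall>A\<in>sets N. \<psi> ` A \<in> sets L)"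

definition regular_cond_prob ::
    "'w measure \<Rightarrow> 'x measure \<Rightarrow> ('w \<Rightarrow> 'x) \<Rightarrow> 't measure \<Rightarrow> ('w \<Rightarrow> 't) \<Rightarrow> ('w \<Rightarrow> 'x measure) \<Rightarrow> bool"
  where
  "regular_cond_prob M Y X L \<Theta> P \<longleftrightarrow>
     P \<in> vimage_algebra (space M) \<Theta> L \<rightarrow>\<^sub>M prob_algebra Y \<and>
     (\<forall>B\<in>sets Y. AE \<omega> in M.
        cond_prob M (vimage_algebra (space M) \<Theta> L) (X -` B \<inter> space M) \<omega> = measure (P \<omega>) B)"

text \<open>The image \<open>(F \<circ> X\<^sup>\<infinity>)(\<Omega>)\<close> carries the trace of the \<open>\<sigma>\<close>-algebra of the space of probability
  measures. The limit of the empirical measures exists almost surely, and \<open>F\<close> is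
  constrained only there.\<close>

definition parametrized_model ::
    "'w measure \<Rightarrow> 'x topology \<Rightarrow> ('w \<Rightarrow> 'x) \<Rightarrow> 't topology \<Rightarrow> ('w \<Rightarrow> 't) \<Rightarrow> ('w \<Rightarrow> 'x measure) \<Rightarrow> bool"
  where
  "parametrized_model M T X L \<Theta> P \<longleftrightarrow>
     (\<exists>Xs F \<psi>.
        exchangeable M (borel_of T) Xs \<and>
        (\<exists>n. \<forall>\<omega>\<in>space M. X \<omega> = Xs n \<omega>) \<and>
        F \<in> (\<Pi>\<^sub>M i\<in>UNIV. borel_of T) \<rightarrow>\<^sub>M prob_algebra (borel_of T) \<and>
        (AE \<omega> in M. weakly_converges T
           (empirical_measure (borel_of T) (\<lambda>i. Xs i \<omega>)) (F (\<lambda>i. Xs i \<omega>))) \<and>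
        bimeasurable_onto
          (restrict_space (prob_algebra (borel_of T)) ((\<lambda>\<omega>. F (\<lambda>i. Xs i \<omega>)) ` space M))
          (borel_of L) \<psi> \<and>
        (\<forall>\<omega>\<in>space M. \<Theta> \<omega> = \<psi> (F (\<lambda>i. Xs i \<omega>)))) \<and>
     regular_cond_prob M (borel_of T) X (borel_of L) \<Theta> P"

text \<open>\<open>P I\<close> and \<open>P\<^sub>D\<close> are the kernels of the models given \<open>\<Theta> I\<close> and \<open>\<Theta>\<^sub>D\<close>.\<close>

definition projective_limit_model ::
    "'w measure \<Rightarrow> 'i set \<Rightarrow> 'i rel \<Rightarrow>
     ('i \<Rightarrow> 'x topology) \<Rightarrow> ('i \<Rightarrow> 'i \<Rightarrow> 'x \<Rightarrow> 'x) \<Rightarrow> ('i \<Rightarrow> 'w \<Rightarrow> 'x) \<Rightarrow>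
     ('i \<Rightarrow> 't topology) \<Rightarrow> ('i \<Rightarrow> 'i \<Rightarrow> 't \<Rightarrow> 't) \<Rightarrow> ('i \<Rightarrow> 'w \<Rightarrow> 't) \<Rightarrow>
     ('i \<Rightarrow> 'w \<Rightarrow> 'x measure) \<Rightarrow> ('w \<Rightarrow> ('i \<Rightarrow> 'x) measure) \<Rightarrow> bool"
  where
  "projective_limit_model M D r TX f X TT g \<Theta> P PD \<longleftrightarrow>
     projective_system D r TX f \<and>
     projective_system D r TT g \<and>
     (\<forall>I\<in>D. parametrized_model M (TX I) (X I) (TT I) (\<Theta> I) (P I)) \<and>
     (\<forall>I J. (I, J) \<in> r \<longrightarrow>
        (\<forall>\<omega>\<in>space M. X I \<omega> = f J I (X J \<omega>) \<and> \<Theta> I \<omega> = g J I (\<Theta> J \<omega>))) \<and>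
     (\<forall>I J. (I, J) \<in> r \<longrightarrow>
        (AE \<omega> in M. distr (P J \<omega>) (borel_of (TX I)) (f J I) = P I \<omega>)) \<and>
     PD \<in> vimage_algebra (space M) (lim_var D \<Theta>) (proj_lim D r TT g)
        \<rightarrow>\<^sub>M prob_algebra (proj_lim D r TX f) \<and>
     (\<forall>I\<in>D. AE \<omega> in M. distr (PD \<omega>) (borel_of (TX I)) (\<lambda>x. x I) = P I \<omega>)"

section \<open>Sufficiency\<close>

text \<open>The join of two \<open>\<sigma>\<close>-algebras on the sample space.\<close>

definition join_alg :: "'w measure \<Rightarrow> 'w measure \<Rightarrow> 'w measure \<Rightarrow> 'w measure" where
  "join_alg M G H = sigma (space M) (sets G \<union> sets H)"

text \<open>The arguments \<open>Y\<close>, \<open>X\<close>, \<open>L\<close>, \<open>\<Theta>\<close> stand for the model \<open>P[X|\<Theta>]\<close>, with values of \<open>X\<close> in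
  \<open>Y\<close> and of \<open>\<Theta>\<close> in \<open>L\<close>. A \<open>\<sigma>\<close>-algebra contained in that of \<open>M\<close> is a subalgebra \<open>G\<close> of \<open>M\<close>,
  and \<open>k\<close> is a probability kernel from \<open>M\<close> to \<open>M\<close>.\<close>

definition sufficient ::
    "'w measure \<Rightarrow> 'w measure \<Rightarrow> 'x measure \<Rightarrow> ('w \<Rightarrow> 'x) \<Rightarrow> 't measure \<Rightarrow> ('w \<Rightarrow> 't) \<Rightarrow> bool"
  where
  "sufficient M G Y X L \<Theta> \<longleftrightarrow>
     subalgebra M G \<and>
     (\<exists>k \<in> M \<rightarrow>\<^sub>M prob_algebra M. \<forall>B\<in>sets Y.
        (\<lambda>\<omega>. measure (k \<omega>) (X -` B \<inter> space M)) \<in> borel_measurable G \<and>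
        (AE \<omega> in M.
           cond_prob M (join_alg M (vimage_algebra (space M) \<Theta> L) G) (X -` B \<inter> space M) \<omega> =
           measure (k \<omega>) (X -` B \<inter> space M)))"

text \<open>The same notion with the set function \<open>B \<mapsto> k (X -` B \<inter> space M)\<close> as the kernel, i.e. a
  probability kernel from \<open>M\<close> to \<open>Y\<close>. Only this restriction of \<open>k\<close> enters the definition above,
  and it can be used on an arbitrary sample space. It is implied by \<open>sufficient\<close> (see below). The converse
  may fail on sample spaces without regular conditional probabilities: if
  \<open>X = (U, V)\<close> is uniform on the unit square and the range of \<open>X\<close> is a graph of full
  outer measure, then \<open>\<sigma>(U)\<close> satisfies \<open>sufficient\<close> for every dyadic discretization of \<open>X\<close>
  (with constant parameter), but not for \<open>X\<close> itself.\<close>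

definition sufficient_law ::
    "'w measure \<Rightarrow> 'w measure \<Rightarrow> 'x measure \<Rightarrow> ('w \<Rightarrow> 'x) \<Rightarrow> 't measure \<Rightarrow> ('w \<Rightarrow> 't) \<Rightarrow> bool"
  where
  "sufficient_law M G Y X L \<Theta> \<longleftrightarrow>
     subalgebra M G \<and>
     (\<exists>k \<in> M \<rightarrow>\<^sub>M prob_algebra Y. \<forall>B\<in>sets Y.
        (\<lambda>\<omega>. measure (k \<omega>) B) \<in> borel_measurable G \<and>
        (AE \<omega> in M.
           cond_prob M (join_alg M (vimage_algebra (space M) \<Theta> L) G) (X -` B \<inter> space M) \<omega> =
           measure (k \<omega>) B))"

definition sufficient_statistic ::
    "'w measure \<Rightarrow> 'x measure \<Rightarrow> ('w \<Rightarrow> 'x) \<Rightarrow> 't measure \<Rightarrow> ('w \<Rightarrow> 't) \<Rightarrow>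
     'u measure \<Rightarrow> ('x \<Rightarrow> 'u) \<Rightarrow> bool"
  where
  "sufficient_statistic M Y X L \<Theta> U S \<longleftrightarrow>
     standard_borel U \<and> S \<in> Y \<rightarrow>\<^sub>M U \<and>
     sufficient M (vimage_algebra (space M) (S \<circ> X) U) Y X L \<Theta>"

definition sufficient_statistic_law ::
    "'w measure \<Rightarrow> 'x measure \<Rightarrow> ('w \<Rightarrow> 'x) \<Rightarrow> 't measure \<Rightarrow> ('w \<Rightarrow> 't) \<Rightarrow>
     'u measure \<Rightarrow> ('x \<Rightarrow> 'u) \<Rightarrow> bool"
  where
  "sufficient_statistic_law M Y X L \<Theta> U S \<longleftrightarrow>
     standard_borel U \<and> S \<in> Y \<rightarrow>\<^sub>M U \<and>
     sufficient_law M (vimage_algebra (space M) (S \<circ> X) U) Y X L \<Theta>"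

lemma sufficient_imp_sufficient_law:
  assumes X: "X \<in> M \<rightarrow>\<^sub>M Y" and "sufficient M G Y X L \<Theta>"
  shows "sufficient_law M G Y X L \<Theta>"
proof -
  obtain k where k: "k \<in> M \<rightarrow>\<^sub>M prob_algebra M" and
    kB: "\<And>B. B \<in> sets Y \<Longrightarrow>
        (\<lambda>\<omega>. measure (k \<omega>) (X -` B \<inter> space M)) \<in> borel_measurable G \<and>
        (AE \<omega> in M.
           cond_prob M (join_alg M (vimage_algebra (space M) \<Theta> L) G) (X -` B \<inter> space M) \<omega> =
           measure (k \<omega>) (X -` B \<inter> space M))"
    and G: "subalgebra M G"
    using assms(2) unfolding sufficient_def by blast
  define k' where "k' \<omega> = distr (k \<omega>) Y X" for \<omega>
  have k': "k' \<in> M \<rightarrow>\<^sub>M prob_algebra Y"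
    unfolding k'_def by (rule measurable_compose[OF k measurable_distr_prob_space[OF X]])
  have eq: "measure (k' \<omega>) B = measure (k \<omega>) (X -` B \<inter> space M)"
    if "\<omega> \<in> space M" "B \<in> sets Y" for \<omega> B
  proof -
    have s: "sets (k \<omega>) = sets M"
      using measurable_space[OF k that(1)] by (simp add: space_prob_algebra)
    then have "X \<in> k \<omega> \<rightarrow>\<^sub>M Y"
      using X by (simp cong: measurable_cong_sets)
    then show ?thesis
      using that(2) sets_eq_imp_space_eq[OF s] by (simp add: k'_def measure_distr)
  qed
  have sp: "space G = space M"
    using G by (simp add: subalgebra_def)
  have "(\<lambda>\<omega>. measure (k' \<omega>) B) \<in> borel_measurable G \<and>
      (AE \<omega> in M.
         cond_prob M (join_alg M (vimage_algebra (space M) \<Theta> L) G) (X -` B \<inter> space M) \<omega> =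
         measure (k' \<omega>) B)" if B: "B \<in> sets Y" for B
  proof
    show "(\<lambda>\<omega>. measure (k' \<omega>) B) \<in> borel_measurable G"
      using kB[OF B] eq[OF _ B] sp by (subst measurable_cong) auto
    show "AE \<omega> in M.
         cond_prob M (join_alg M (vimage_algebra (space M) \<Theta> L) G) (X -` B \<inter> space M) \<omega> =
         measure (k' \<omega>) B"
      using conjunct2[OF kB[OF B]] AE_space by eventually_elim (simp add: eq B)
  qed
  then show ?thesis
    unfolding sufficient_law_def using G k' by blast
qed

end

theory Submission
  imports Defs
begin

text \<open>Write \<open>G\<^sub>D\<close> for the \<open>\<sigma>\<close>-algebra generated by the \<open>G I\<close>, and similarly \<open>X\<^sub>D\<close>, \<open>\<Theta>\<^sub>D\<close>. Sufficiency of \<open>G I\<close>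
  says that the conditional probabilities of events of \<open>X I\<close> given \<open>\<Theta> I\<close> and \<open>G I\<close> have
  \<open>G I\<close>-measurable versions, which moreover form a kernel.

  An event \<open>A\<close> of \<open>X I\<close> is also an event of \<open>X J\<close> for every \<open>J\<close> above \<open>I\<close>. So along all these \<open>J\<close> the
  conditional probability of \<open>A\<close> given \<open>\<Theta> J\<close> and \<open>G J\<close> is \<open>G J\<close>-measurable. As \<open>J\<close> increases it tends
  in the mean to the conditional probability given \<open>\<Theta>\<^sub>D\<close> and \<open>G\<^sub>D\<close>, which is therefore equal to the
  conditional probability given \<open>G\<^sub>D\<close> alone. The lemma \<open>real_cond_exp_join_eq\<close> gives this without
  martingale theory, from the density of the variables measurable for some \<open>G J\<close>.

  Since the projective limit of Polish spaces is Polish (\<open>standard_borel_proj_lim\<close>), there is a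
  regular conditional probability of \<open>X\<^sub>D\<close> given \<open>G\<^sub>D\<close> (\<open>ex_kernel_standard_borel\<close>). It agrees with the
  conditional probability given \<open>\<Theta>\<^sub>D\<close> and \<open>G\<^sub>D\<close> on the events of the single coordinates, which form an
  intersection-stable generator, hence everywhere (\<open>cond_prob_XD_eq\<close>). This is the kernel that
  sufficiency of \<open>G\<^sub>D\<close> asks for. If the kernel is to live on the sample space, one takes the regular
  conditional probability of the identity instead, which exists when the sample space is standard
  Borel. Regular conditional probabilities are first built on the Cantor space, where countably
  many cylinder weights determine a law, and then transferred, as every nonempty Polish space is a
  measurable retract of the Cantor space (\<open>polish_cantor_retract\<close>).

  For statistics the claim follows because \<open>S\<^sub>D \<circ> X\<^sub>D\<close> generates the join of the \<open>\<sigma>\<close>-algebras of the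
  \<open>S I \<circ> X I\<close>. The converse, from the limit to the marginals, is the tower property
  (\<open>cond_prob_marginal\<close>): a \<open>C\<close>-measurable version given \<open>\<Theta>\<^sub>D\<close> and \<open>C\<close> is also one given \<open>\<Theta> I\<close> and \<open>C\<close>.\<close>

section \<open>Laws on the Cantor space\<close>

abbreviation cantor :: "(nat \<Rightarrow> bool) measure" where
  "cantor \<equiv> \<Pi>\<^sub>M i\<in>UNIV. count_space UNIV"

definition cylinder :: "bool list \<Rightarrow> (nat \<Rightarrow> bool) set" where
  "cylinder s = {b. map b [0..<length s] = s}"

lemma space_cantor [simp]: "space cantor = UNIV"
  by (simp add: space_PiM PiE_UNIV_domain)

lemma cylinder_iff: "b \<in> cylinder s \<longleftrightarrow> (\<forall>i<length s. b i = s ! i)"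
  using list_eq_iff_nth_eq[of "map b [0..<length s]" s] by (simp add: cylinder_def)

lemma cylinder_measurable [measurable]: "cylinder s \<in> sets cantor"
proof -
  have "cylinder s = (\<Inter>i\<in>{..<length s}. {b \<in> space cantor. b i = s ! i}) \<inter> space cantor"
    by (auto simp: cylinder_iff)
  also have "\<dots> \<in> sets cantor"
    by measurable
  finally show ?thesis .
qed

lemma cylinder_Int:
  assumes "length s \<le> length t"
  shows "cylinder s \<inter> cylinder t = (if take (length s) t = s then cylinder t else {})"
proof -
  have "map b [0..<length s] = take (length s) t" if "map b [0..<length t] = t" for b
    using assms arg_cong[OF that, of "take (length s)"] by (simp add: take_map)
  then show ?thesis
    by (auto simp: cylinder_def)
qed

text \<open>Two cylinders are nested or disjoint, so they form an intersection-stable generator once the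
  empty set is added. This makes a law on the Cantor space determined by its values on cylinders.\<close>
lemma Int_stable_cylinders: "Int_stable (insert {} (range cylinder))"
proof (rule Int_stableI)
  have le: "cylinder s \<inter> cylinder t \<in> insert {} (range cylinder)" if "length s \<le> length t" for s t
    using cylinder_Int[OF that] by (cases "take (length s) t = s") simp_all
  have *: "cylinder s \<inter> cylinder t \<in> insert {} (range cylinder)" for s t
  proof (cases "length s \<le> length t")
    case False
    then show ?thesis using le[of t s] by (simp only: Int_commute[of "cylinder s"])
  qed (rule le)
  then show "a \<inter> b \<in> insert {} (range cylinder)"
    if "a \<in> insert {} (range cylinder)" "b \<in> insert {} (range cylinder)" for a b
  proof (cases "a = {} \<or> b = {}")
    case False
    with that obtain s t where "a = cylinder s" "b = cylinder t" by blast
    with *[of s t] show ?thesis by simp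
  qed auto
qed

lemma sets_cantor: "sets cantor = sigma_sets UNIV (insert {} (range cylinder))"
proof
  let ?S = "sigma UNIV (insert {} (range cylinder))"
  have "(\<lambda>b i. b i) \<in> ?S \<rightarrow>\<^sub>M cantor"
  proof (rule measurable_PiM_single'[where f = "\<lambda>i b. b i"])
    fix i :: nat
    have sets: "{b. b i = v} \<in> sets ?S" for v
    proof -
      have "{b. b i = v} = (\<Union>s\<in>{s. length s = Suc i \<and> s ! i = v}. cylinder s)"
      proof (intro set_eqI iffI)
        fix b :: "nat \<Rightarrow> bool" assume "b \<in> {b. b i = v}"
        then have "map b [0..<Suc i] ! i = v"
          by (subst nth_map) (simp_all del: upt_Suc)
        moreover have "b \<in> cylinder (map b [0..<Suc i])"
          unfolding cylinder_def by (simp del: upt_Suc)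
        ultimately show "b \<in> (\<Union>s\<in>{s. length s = Suc i \<and> s ! i = v}. cylinder s)"
          by (intro UN_I[of "map b [0..<Suc i]"]) (simp_all del: upt_Suc)
      next
        fix b assume "b \<in> (\<Union>s\<in>{s. length s = Suc i \<and> s ! i = v}. cylinder s)"
        then obtain s where "length s = Suc i" "s ! i = v" "b \<in> cylinder s"
          by blast
        then show "b \<in> {b. b i = v}"
          by (simp add: cylinder_iff)
      qed
      also have "\<dots> \<in> sets ?S"
      proof (rule sets.countable_UN')
        show "cylinder ` {s. length s = Suc i \<and> s ! i = v} \<subseteq> sets ?S"
          by auto
      qed (rule countableI_type)
      finally show ?thesis .
    qed
    have "(\<lambda>b. b i) -` {v} \<inter> space ?S \<in> sets ?S" for v
      using sets[of v] by (simp add: vimage_def)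
    then show "(\<lambda>b. b i) \<in> ?S \<rightarrow>\<^sub>M count_space UNIV"
      by (subst measurable_count_space_eq2_countable) auto
  qed auto
  from measurable_sets[OF this] show "sets cantor \<subseteq> sigma_sets UNIV (insert {} (range cylinder))"
    by auto
  have "insert {} (range cylinder) \<subseteq> sets cantor" by auto
  from sets.sigma_sets_subset[OF this]
  show "sigma_sets UNIV (insert {} (range cylinder)) \<subseteq> sets cantor" by simp
qed

text \<open>A consistent assignment \<open>p\<close> of weights to finite words is realized by bisection: the word \<open>s\<close>
  owns an interval of length \<open>p s\<close> in the unit interval, and the intervals of \<open>s @ [False]\<close> and
  \<open>s @ [True]\<close> lie side by side in that of \<open>s\<close>, in this order. The left end point of the interval
  of \<open>s\<close> is the total weight of the words that leave \<open>s\<close> to the left at some letter \<open>True\<close> of \<open>s\<close>.\<close>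
definition left_end :: "(bool list \<Rightarrow> real) \<Rightarrow> bool list \<Rightarrow> real" where
  "left_end p s = (\<Sum>i<length s. if s ! i then p (take i s @ [False]) else 0)"

text \<open>The word of length \<open>n\<close> whose interval contains \<open>u\<close>.\<close>
primrec bisect :: "(bool list \<Rightarrow> real) \<Rightarrow> real \<Rightarrow> nat \<Rightarrow> bool list" where
  "bisect p u 0 = []"
| "bisect p u (Suc n) =
     bisect p u n @ [left_end p (bisect p u n) + p (bisect p u n @ [False]) \<le> u]"

definition digits :: "(bool list \<Rightarrow> real) \<Rightarrow> real \<Rightarrow> nat \<Rightarrow> bool" where
  "digits p u n = last (bisect p u (Suc n))"

lemma left_end_snoc:
  "left_end p [] = 0"
  "left_end p (s @ [b]) = left_end p s + (if b then p (s @ [False]) else 0)"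
proof -
  have "(\<Sum>i<length s. if (s @ [b]) ! i then p (take i (s @ [b]) @ [False]) else 0) =
        (\<Sum>i<length s. if s ! i then p (take i s @ [False]) else 0)"
    by (rule sum.cong) (auto simp: nth_append)
  then show "left_end p (s @ [b]) = left_end p s + (if b then p (s @ [False]) else 0)"
    by (simp add: left_end_def)
qed (simp add: left_end_def)

lemma map_digits: "map (digits p u) [0..<n] = bisect p u n"
  by (induction n) (auto simp: digits_def)

lemma measurable_digits: "digits p \<in> borel \<rightarrow>\<^sub>M cantor"
proof -
  have bisect: "(\<lambda>u. bisect p u n) \<in> borel \<rightarrow>\<^sub>M count_space UNIV" for n
  proof (induction n)
    case (Suc n)
    have "(\<lambda>u. s @ [left_end p s + p (s @ [False]) \<le> u]) \<in> borel \<rightarrow>\<^sub>M count_space UNIV" for s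
    proof -
      have "(\<lambda>u::real. c \<le> u) \<in> borel \<rightarrow>\<^sub>M count_space UNIV" for c
        by measurable
      from measurable_compose[OF this measurable_count_space] show ?thesis .
    qed
    \<comment> \<open>The previous word takes countably many values, and the next letter is measurable in \<open>u\<close> for
      each of them.\<close>
    from measurable_compose_countable[where
        f = "\<lambda>s u. s @ [left_end p s + p (s @ [False]) \<le> u]", OF this Suc]
    show ?case by simp
  qed simp
  have "(\<lambda>u. digits p u n) \<in> borel \<rightarrow>\<^sub>M count_space UNIV" for n
    unfolding digits_def by (rule measurable_compose[OF bisect]) simp
  then show ?thesis
    by (intro measurable_PiM_single'[where f = "\<lambda>n u. digits p u n"]) auto
qed

definition cylinder_weights :: "(bool list \<Rightarrow> real) \<Rightarrow> bool" where
  "cylinder_weights p \<longleftrightarrow>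
     p [] = 1 \<and> (\<forall>s. 0 \<le> p s) \<and> (\<forall>s. p (s @ [False]) + p (s @ [True]) = p s)"

lemma left_end_bounds:
  assumes "cylinder_weights p"
  shows "0 \<le> left_end p s \<and> left_end p s + p s \<le> 1"
proof (induction s rule: rev_induct)
  case (snoc b s)
  have "p (s @ [False]) + p (s @ [True]) = p s" "0 \<le> p (s @ [False])" "0 \<le> p (s @ [True])"
    using assms unfolding cylinder_weights_def by simp_all
  with snoc show ?case by (cases b) (auto simp: left_end_snoc)
qed (use assms in \<open>auto simp: left_end_snoc cylinder_weights_def\<close>)

lemma bisect_eq_iff:
  assumes p: "cylinder_weights p" and u: "0 \<le> u" "u < 1"
  shows "bisect p u (length s) = s \<longleftrightarrow> u \<in> {left_end p s..<left_end p s + p s}"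
proof (induction s rule: rev_induct)
  case Nil
  then show ?case using p u by (auto simp: left_end_snoc cylinder_weights_def)
next
  case (snoc b s)
  have "p (s @ [False]) + p (s @ [True]) = p s" "0 \<le> p (s @ [False])" "0 \<le> p (s @ [True])"
    using p unfolding cylinder_weights_def by simp_all
  with snoc show ?case by (cases b) (auto simp: left_end_snoc)
qed

text \<open>The law of the digits of a uniform variable gives the cylinder of \<open>s\<close> the length \<open>p s\<close> of its
  interval. The explicit construction replaces an extension theorem for premeasures.\<close>
definition cantor_law :: "(bool list \<Rightarrow> real) \<Rightarrow> (nat \<Rightarrow> bool) measure" where
  "cantor_law p = distr (uniform_measure lborel {0..<1}) cantor (digits p)"

lemma prob_space_cantor_law: "prob_space (cantor_law p)"
  unfolding cantor_law_def
proof (rule prob_space.prob_space_distr)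
  show "prob_space (uniform_measure lborel {0..<1::real})"
    by (rule prob_space_uniform_measure) auto
  show "digits p \<in> uniform_measure lborel {0..<1} \<rightarrow>\<^sub>M cantor"
    using measurable_digits by (subst measurable_cong_sets[OF _ refl, where M' = borel]) simp_all
qed

lemma sets_cantor_law [simp]: "sets (cantor_law p) = sets cantor"
  by (simp add: cantor_law_def)

lemma emeasure_cantor_law_cylinder:
  assumes p: "cylinder_weights p"
  shows "emeasure (cantor_law p) (cylinder s) = ennreal (p s)"
proof -
  have "digits p -` cylinder s \<inter> {0..<1} = {left_end p s..<left_end p s + p s}"
    using left_end_bounds[OF p, of s] bisect_eq_iff[OF p, of _ s]
    by (auto simp: cylinder_def map_digits)
  moreover have "digits p -` cylinder s \<in> sets borel"
    using measurable_sets[OF measurable_digits cylinder_measurable, of p s] by simp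
  moreover have "0 \<le> p s"
    using p by (simp add: cylinder_weights_def)
  ultimately show ?thesis
    using measurable_digits[of p]
    by (simp add: cantor_law_def emeasure_distr Int_commute[of "{0..<1}"]
        divide_ennreal[of "p s" 1, simplified])
qed

section \<open>Conditional probabilities as kernels\<close>

lemma (in prob_space) sigma_finite_subalgebra_of_subalgebra:
  "subalgebra M F \<Longrightarrow> sigma_finite_subalgebra M F"
  using finite_measure_axioms
  by (intro finite_measure_subalgebra_is_sigma_finite finite_measure_subalgebra.intro
      finite_measure_subalgebra_axioms.intro)

lemma subprob_kernel_emeasure_measurable:
  assumes "k \<in> M \<rightarrow>\<^sub>M prob_algebra Y" "B \<in> sets Y"
  shows "(\<lambda>\<omega>. emeasure (k \<omega>) B) \<in> borel_measurable M"
  by (rule measurable_compose[OF measurable_prob_algebraD[OF assms(1)]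
        measurable_emeasure_subprob_algebra[OF assms(2)]])

lemma prob_kernelD:
  assumes "k \<in> M \<rightarrow>\<^sub>M prob_algebra Y" "\<omega> \<in> space M"
  shows "prob_space (k \<omega>)" "sets (k \<omega>) = sets Y" "space (k \<omega>) = space Y"
  using measurable_space[OF assms] sets_eq_imp_space_eq[of "k \<omega>" Y]
  by (auto simp: space_prob_algebra)

text \<open>Both sides are finite measures in \<open>B\<close> of the same total mass, so they agree on the
  \<open>\<sigma>\<close>-algebra as soon as they agree on an intersection-stable generator.\<close>
lemma joint_law_eqI:
  assumes M: "prob_space M" and X: "X \<in> M \<rightarrow>\<^sub>M Y" and k: "k \<in> M \<rightarrow>\<^sub>M prob_algebra Y"
    and gen: "sets Y = sigma_sets (space Y) E" "Int_stable E" "E \<subseteq> Pow (space Y)"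
    and Q: "Q \<in> sets M"
    and eq: "\<And>B. B \<in> E \<Longrightarrow>
      emeasure M (X -` B \<inter> Q) = (\<integral>\<^sup>+\<omega>. indicator Q \<omega> * emeasure (k \<omega>) B \<partial>M)"
    and B: "B \<in> sets Y"
  shows "emeasure M (X -` B \<inter> Q) = (\<integral>\<^sup>+\<omega>. indicator Q \<omega> * emeasure (k \<omega>) B \<partial>M)"
proof -
  interpret prob_space M by fact
  note kD = prob_kernelD[OF k]
  have pre: "X -` B \<inter> Q \<in> sets M" if "B \<in> sets Y" for B
  proof -
    have "X -` B \<inter> Q = (X -` B \<inter> space M) \<inter> Q"
      using sets.sets_into_space[OF Q] by auto
    then show ?thesis using measurable_sets[OF X that] Q by auto
  qed
  have km [measurable]: "(\<lambda>\<omega>. emeasure (k \<omega>) B) \<in> borel_measurable M" if "B \<in> sets Y" for B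
    by (rule subprob_kernel_emeasure_measurable[OF k that])
  note Q [measurable]
  have spQ: "Q \<subseteq> space M" by (rule sets.sets_into_space[OF Q])
  have "B \<in> sigma_sets (space Y) E" using B gen(1) by simp
  from gen(2,3) this show ?thesis
  proof (induction rule: sigma_sets_induct_disjoint)
    case (basic A) then show ?case by (rule eq)
  next
    case empty then show ?case by simp
  next
    case (compl A)
    then have A: "A \<in> sets Y" using gen(1) by simp
    have "X -` (space Y - A) \<inter> Q = Q - (X -` A \<inter> Q)"
      using measurable_space[OF X] spQ by auto
    then have "emeasure M (X -` (space Y - A) \<inter> Q) = emeasure M Q - emeasure M (X -` A \<inter> Q)"
      using emeasure_Diff[of M "X -` A \<inter> Q" Q] pre[OF A] Q by auto
    also have "\<dots> = (\<integral>\<^sup>+\<omega>. indicator Q \<omega> \<partial>M) - (\<integral>\<^sup>+\<omega>. indicator Q \<omega> * emeasure (k \<omega>) A \<partial>M)"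
      using compl Q by simp
    also have "\<dots> = (\<integral>\<^sup>+\<omega>. indicator Q \<omega> - indicator Q \<omega> * emeasure (k \<omega>) A \<partial>M)"
    proof (rule nn_integral_diff[symmetric])
      have "(\<integral>\<^sup>+\<omega>. indicator Q \<omega> * emeasure (k \<omega>) A \<partial>M) = emeasure M (X -` A \<inter> Q)"
        using compl by simp
      then show "(\<integral>\<^sup>+\<omega>. indicator Q \<omega> * emeasure (k \<omega>) A \<partial>M) \<noteq> \<infinity>"
        by simp
      show "AE \<omega> in M. indicator Q \<omega> * emeasure (k \<omega>) A \<le> indicator Q \<omega>"
        using kD(1) by (intro AE_I2) (auto simp: indicator_def prob_space.emeasure_le_1)
    qed (use A in measurable)
    also have "\<dots> = (\<integral>\<^sup>+\<omega>. indicator Q \<omega> * emeasure (k \<omega>) (space Y - A) \<partial>M)"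
    proof (rule nn_integral_cong)
      fix \<omega> assume \<omega>: "\<omega> \<in> space M"
      have "emeasure (k \<omega>) (space Y - A) = 1 - emeasure (k \<omega>) A"
        using emeasure_compl[of A "k \<omega>"] A kD[OF \<omega>] prob_space.emeasure_space_1[OF kD(1)[OF \<omega>]]
          prob_space.finite_measure[OF kD(1)[OF \<omega>]] finite_measure.emeasure_finite[of "k \<omega>" A] by simp
      then show "indicator Q \<omega> - indicator Q \<omega> * emeasure (k \<omega>) A =
          indicator Q \<omega> * emeasure (k \<omega>) (space Y - A)"
        by (simp add: indicator_def)
    qed
    finally show ?case .
  next
    case (union A)
    then have A: "A i \<in> sets Y" for i using gen(1) by auto
    have dis: "disjoint_family (\<lambda>i. X -` A i \<inter> Q)"
      using union(1) unfolding disjoint_family_on_def by blast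
    have "X -` (\<Union>i. A i) \<inter> Q = (\<Union>i. X -` A i \<inter> Q)" by blast
    also have "emeasure M \<dots> = (\<Sum>i. emeasure M (X -` A i \<inter> Q))"
      using pre[OF A] by (intro suminf_emeasure[symmetric] dis) blast
    finally have "emeasure M (X -` (\<Union>i. A i) \<inter> Q) = (\<Sum>i. emeasure M (X -` A i \<inter> Q))" .
    also have "(\<Sum>i. emeasure M (X -` A i \<inter> Q)) = (\<Sum>i. \<integral>\<^sup>+\<omega>. indicator Q \<omega> * emeasure (k \<omega>) (A i) \<partial>M)"
      using union by simp
    also have "\<dots> = (\<integral>\<^sup>+\<omega>. (\<Sum>i. indicator Q \<omega> * emeasure (k \<omega>) (A i)) \<partial>M)"
      using A by (intro nn_integral_suminf[symmetric]) measurable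
    also have "\<dots> = (\<integral>\<^sup>+\<omega>. indicator Q \<omega> * emeasure (k \<omega>) (\<Union>i. A i) \<partial>M)"
    proof (rule nn_integral_cong)
      fix \<omega> assume \<omega>: "\<omega> \<in> space M"
      show "(\<Sum>i. indicator Q \<omega> * emeasure (k \<omega>) (A i)) = indicator Q \<omega> * emeasure (k \<omega>) (\<Union>i. A i)"
      proof -
        have "range A \<subseteq> sets (k \<omega>)" using A kD(2)[OF \<omega>] by blast
        from suminf_emeasure[OF this union(1)] show ?thesis by simp
      qed
    qed
    finally show ?case .
  qed
qed

text \<open>This form of the defining property is what the proofs below manipulate: it turns statements
  about versions into identities between numbers.\<close>
lemma cond_prob_eq_iff:
  assumes M: "prob_space M" and F: "subalgebra M F" and A: "A \<in> sets M"
    and g: "g \<in> borel_measurable F" and bd: "\<And>\<omega>. \<omega> \<in> space M \<Longrightarrow> \<bar>g \<omega>\<bar> \<le> (1::real)"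
  shows "(AE \<omega> in M. cond_prob M F A \<omega> = g \<omega>) \<longleftrightarrow>
    (\<forall>Q\<in>sets F. measure M (A \<inter> Q) = (\<integral>\<omega>. indicator Q \<omega> * g \<omega> \<partial>M))"
proof -
  interpret prob_space M by fact
  interpret sigma_finite_subalgebra M F
    by (rule sigma_finite_subalgebra_of_subalgebra[OF F])
  note A [measurable]
  have FM: "Q \<in> sets M" if "Q \<in> sets F" for Q
    using F that by (auto simp: subalgebra_def)
  have gM [measurable]: "g \<in> borel_measurable M"
    by (rule measurable_from_subalg[OF F g])
  have bnd: "integrable M \<phi>"
    if "\<phi> \<in> borel_measurable M" "\<And>\<omega>. \<omega> \<in> space M \<Longrightarrow> \<bar>\<phi> \<omega>\<bar> \<le> 1" for \<phi> :: "'a \<Rightarrow> real"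
    using that by (intro integrable_const_bound[where B = 1] AE_I2) simp_all
  have ind: "(\<integral>\<omega>. indicator Q \<omega> * indicator A \<omega> \<partial>M) = measure M (A \<inter> Q)" if "Q \<in> sets F" for Q
  proof -
    have "indicator Q \<omega> * indicator A \<omega> = (indicator (A \<inter> Q) \<omega> :: real)" for \<omega>
      by (simp split: split_indicator)
    then show ?thesis using FM[OF that] by simp
  qed
  show ?thesis
  proof
    assume ae: "AE \<omega> in M. cond_prob M F A \<omega> = g \<omega>"
    show "\<forall>Q\<in>sets F. measure M (A \<inter> Q) = (\<integral>\<omega>. indicator Q \<omega> * g \<omega> \<partial>M)"
    proof
      fix Q assume Q: "Q \<in> sets F"
      note FM[OF Q, measurable]
      have "measure M (A \<inter> Q) = (\<integral>\<omega>. indicator Q \<omega> * cond_prob M F A \<omega> \<partial>M)"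
        unfolding cond_prob_def ind[OF Q, symmetric]
      proof (rule real_cond_exp_intg(2)[symmetric])
        show "integrable M (\<lambda>\<omega>. indicator Q \<omega> * indicator A \<omega> :: real)"
        proof (rule bnd)
          show "(\<lambda>\<omega>. indicator Q \<omega> * indicator A \<omega> :: real) \<in> borel_measurable M"
            by measurable
        qed (simp add: indicator_def)
        show "(indicator Q :: 'a \<Rightarrow> real) \<in> borel_measurable F"
          using Q by simp
        show "(indicator A :: 'a \<Rightarrow> real) \<in> borel_measurable M"
          using A by simp
      qed
      also have "\<dots> = (\<integral>\<omega>. indicator Q \<omega> * g \<omega> \<partial>M)"
      proof (rule integral_cong_AE)
        show "(\<lambda>\<omega>. indicator Q \<omega> * cond_prob M F A \<omega>) \<in> borel_measurable M"
          unfolding cond_prob_def by measurable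
        show "AE \<omega> in M. indicator Q \<omega> * cond_prob M F A \<omega> = indicator Q \<omega> * g \<omega>"
          using ae by eventually_elim simp
      qed measurable
      finally show "measure M (A \<inter> Q) = (\<integral>\<omega>. indicator Q \<omega> * g \<omega> \<partial>M)" .
    qed
  next
    assume eq: "\<forall>Q\<in>sets F. measure M (A \<inter> Q) = (\<integral>\<omega>. indicator Q \<omega> * g \<omega> \<partial>M)"
    show "AE \<omega> in M. cond_prob M F A \<omega> = g \<omega>"
      unfolding cond_prob_def
    proof (rule real_cond_exp_charact)
      show "(\<integral>\<omega>\<in>Q. indicator A \<omega> \<partial>M) = (\<integral>\<omega>\<in>Q. g \<omega> \<partial>M)" if "Q \<in> sets F" for Q
        using eq ind that by (simp add: set_lebesgue_integral_def)
      show "integrable M g"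
        by (rule bnd[OF gM bd])
      show "integrable M (indicator A :: 'a \<Rightarrow> real)"
        by (rule bnd) (simp_all add: indicator_def)
    qed (rule g)
  qed
qed

text \<open>Integrated over a fixed event of \<open>F\<close>, the claim is an identity between two measures in \<open>B\<close>. So
  it may be checked on a generator, although the exceptional null set depends on \<open>B\<close>.\<close>
lemma cond_prob_kernel_eqI:
  assumes M: "prob_space M" and F: "subalgebra M F" and X: "X \<in> M \<rightarrow>\<^sub>M Y"
    and k: "k \<in> F \<rightarrow>\<^sub>M prob_algebra Y"
    and gen: "sets Y = sigma_sets (space Y) E" "Int_stable E" "E \<subseteq> Pow (space Y)"
    and eq: "\<And>B. B \<in> E \<Longrightarrow>
      AE \<omega> in M. cond_prob M F (X -` B \<inter> space M) \<omega> = measure (k \<omega>) B"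
    and B: "B \<in> sets Y"
  shows "AE \<omega> in M. cond_prob M F (X -` B \<inter> space M) \<omega> = measure (k \<omega>) B"
proof -
  interpret prob_space M by fact
  have kM: "k \<in> M \<rightarrow>\<^sub>M prob_algebra Y"
    by (rule measurable_from_subalg[OF F k])
  have mF: "(\<lambda>\<omega>. measure (k \<omega>) C) \<in> borel_measurable F" if "C \<in> sets Y" for C
    by (rule measurable_compose[OF k measurable_measure_prob_algebra[OF that]])
  have le1: "\<bar>measure (k \<omega>) C\<bar> \<le> 1" if "\<omega> \<in> space M" for \<omega> C
    using prob_space.prob_le_1[OF prob_kernelD(1)[OF kM that]] by simp
  have iff: "(AE \<omega> in M. cond_prob M F (X -` C \<inter> space M) \<omega> = measure (k \<omega>) C) \<longleftrightarrow>
      (\<forall>Q\<in>sets F. emeasure M (X -` C \<inter> Q) = (\<integral>\<^sup>+\<omega>. indicator Q \<omega> * emeasure (k \<omega>) C \<partial>M))"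
    if C: "C \<in> sets Y" for C
  proof (subst cond_prob_eq_iff[OF M F measurable_sets[OF X C] mF[OF C] le1], assumption,
      intro ball_cong refl)
    fix Q assume "Q \<in> sets F"
    then have Q [measurable]: "Q \<in> sets M" using F by (auto simp: subalgebra_def)
    have [measurable]: "(\<lambda>\<omega>. measure (k \<omega>) C) \<in> borel_measurable M"
      by (rule measurable_from_subalg[OF F mF[OF C]])
    have "(\<integral>\<^sup>+\<omega>. indicator Q \<omega> * emeasure (k \<omega>) C \<partial>M) =
        (\<integral>\<^sup>+\<omega>. ennreal (indicator Q \<omega> * measure (k \<omega>) C) \<partial>M)"
    proof (rule nn_integral_cong)
      fix \<omega> assume "\<omega> \<in> space M"
      then have "emeasure (k \<omega>) C = ennreal (measure (k \<omega>) C)"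
        using prob_kernelD(1)[OF kM] prob_space.finite_measure
        by (intro finite_measure.emeasure_eq_measure) blast
      then show "indicator Q \<omega> * emeasure (k \<omega>) C = ennreal (indicator Q \<omega> * measure (k \<omega>) C)"
        by (simp split: split_indicator)
    qed
    also have "\<dots> = ennreal (\<integral>\<omega>. indicator Q \<omega> * measure (k \<omega>) C \<partial>M)"
    proof (rule nn_integral_eq_integral)
      show "integrable M (\<lambda>\<omega>. indicator Q \<omega> * measure (k \<omega>) C)"
      proof (rule integrable_const_bound[where B = 1])
        show "AE \<omega> in M. norm (indicator Q \<omega> * measure (k \<omega>) C) \<le> 1"
          using le1 by (intro AE_I2) (simp add: indicator_def)
      qed measurable
    qed simp
    finally have r: "(\<integral>\<^sup>+\<omega>. indicator Q \<omega> * emeasure (k \<omega>) C \<partial>M) =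
      ennreal (\<integral>\<omega>. indicator Q \<omega> * measure (k \<omega>) C \<partial>M)" .
    have "X -` C \<inter> space M \<inter> Q = X -` C \<inter> Q"
      using sets.sets_into_space[OF Q] by auto
    then show "(measure M (X -` C \<inter> space M \<inter> Q) = (\<integral>\<omega>. indicator Q \<omega> * measure (k \<omega>) C \<partial>M)) =
        (emeasure M (X -` C \<inter> Q) = (\<integral>\<^sup>+\<omega>. indicator Q \<omega> * emeasure (k \<omega>) C \<partial>M))"
      unfolding r by (simp add: emeasure_eq_measure Bochner_Integration.integral_nonneg)
  qed
  have "C \<in> sets Y" if "C \<in> E" for C
    using gen that by auto
  then have "emeasure M (X -` B \<inter> Q) = (\<integral>\<^sup>+\<omega>. indicator Q \<omega> * emeasure (k \<omega>) B \<partial>M)"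
    if "Q \<in> sets F" for Q
    using that F eq iff by (intro joint_law_eqI[OF M X kM gen _ _ B]) (auto simp: subalgebra_def)
  then show ?thesis
    using iff[OF B] by blast
qed


text \<open>There are only countably many cylinders. Hence, outside one null set, the conditional
  probabilities of all of them form consistent weights, and bisection turns these into a law. The
  measurable dependence on the sample point need only be checked on cylinders.\<close>
lemma ex_kernel_cantor:
  assumes M: "prob_space M" and F: "subalgebra M F" and X: "X \<in> M \<rightarrow>\<^sub>M cantor"
  shows "\<exists>k \<in> F \<rightarrow>\<^sub>M prob_algebra cantor. \<forall>B\<in>sets cantor.
    AE \<omega> in M. cond_prob M F (X -` B \<inter> space M) \<omega> = measure (k \<omega>) B"
proof -
  interpret prob_space M by fact
  interpret sigma_finite_subalgebra M F
    by (rule sigma_finite_subalgebra_of_subalgebra[OF F])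
  define A where "A s = X -` cylinder s \<inter> space M" for s
  have A [measurable]: "A s \<in> sets M" for s
    unfolding A_def by (rule measurable_sets[OF X cylinder_measurable])
  have int: "integrable M (indicator (A s) :: _ \<Rightarrow> real)" for s
    by (simp add: emeasure_eq_measure)
  define q where "q \<omega> s = cond_prob M F (A s) \<omega>" for \<omega> s
  have q [measurable]: "(\<lambda>\<omega>. q \<omega> s) \<in> borel_measurable F" for s
    unfolding q_def cond_prob_def by simp
  have weights: "AE \<omega> in M. cylinder_weights (q \<omega>)"
  proof -
    have 1: "AE \<omega> in M. q \<omega> [] = 1"
    proof -
      have "A [] = space M"
        using measurable_space[OF X] by (auto simp: A_def cylinder_def)
      moreover have "space M \<in> sets F"
        using F sets.top[of F] by (simp add: subalgebra_def)
      then have "(indicator (space M) :: _ \<Rightarrow> real) \<in> borel_measurable F"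
        by (rule borel_measurable_indicator)
      ultimately have "AE \<omega> in M. q \<omega> [] = indicator (space M) \<omega>"
        using real_cond_exp_F_meas[OF int[of "[]"]] by (simp add: q_def cond_prob_def)
      then show ?thesis
        using AE_space by eventually_elim simp
    qed
    have 2: "AE \<omega> in M. \<forall>s. 0 \<le> q \<omega> s"
      unfolding AE_all_countable
    proof
      fix s show "AE \<omega> in M. 0 \<le> q \<omega> s"
        unfolding q_def cond_prob_def by (rule real_cond_exp_pos) simp_all
    qed
    have 3: "AE \<omega> in M. \<forall>s. q \<omega> (s @ [False]) + q \<omega> (s @ [True]) = q \<omega> s"
      unfolding AE_all_countable
    proof
      fix s
      have "indicator (A (s @ [False])) \<omega> + indicator (A (s @ [True])) \<omega> = (indicator (A s) \<omega> :: real)" for \<omega>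
        by (auto simp: A_def cylinder_def split: split_indicator)
      then have "(\<lambda>\<omega>. indicator (A (s @ [False])) \<omega> + indicator (A (s @ [True])) \<omega> :: real) = indicator (A s)"
        by blast
      with real_cond_exp_add[OF int[of "s @ [False]"] int[of "s @ [True]"]]
      show "AE \<omega> in M. q \<omega> (s @ [False]) + q \<omega> (s @ [True]) = q \<omega> s"
        unfolding q_def cond_prob_def by (simp add: eq_commute)
    qed
    from 1 2 3 show ?thesis
      unfolding cylinder_weights_def by eventually_elim blast
  qed
  \<comment> \<open>On the exceptional null set any consistent weights will do; these are those of the fair coin.\<close>
  define p where "p \<omega> = (if cylinder_weights (q \<omega>) then q \<omega> else (\<lambda>s. (1 / 2) ^ length s))" for \<omega>
  have p: "cylinder_weights (p \<omega>)" for \<omega>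
    by (simp add: p_def) (simp add: cylinder_weights_def)
  have [measurable]: "Measurable.pred F (\<lambda>\<omega>. cylinder_weights (q \<omega>))"
    unfolding cylinder_weights_def by measurable
  have pm: "(\<lambda>\<omega>. p \<omega> s) \<in> borel_measurable F" for s
  proof -
    have "(\<lambda>\<omega>. p \<omega> s) = (\<lambda>\<omega>. if cylinder_weights (q \<omega>) then q \<omega> s else (1 / 2) ^ length s)"
      by (auto simp: p_def)
    then show ?thesis by simp
  qed
  have k: "(\<lambda>\<omega>. cantor_law (p \<omega>)) \<in> F \<rightarrow>\<^sub>M prob_algebra cantor"
  proof (rule measurable_prob_algebra_generated[OF sets_cantor Int_stable_cylinders])
    fix B assume "B \<in> insert {} (range cylinder)"
    then show "(\<lambda>\<omega>. emeasure (cantor_law (p \<omega>)) B) \<in> borel_measurable F"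
      using pm by (auto simp: emeasure_cantor_law_cylinder[OF p])
  qed (auto simp: prob_space_cantor_law)
  have "AE \<omega> in M. cond_prob M F (X -` B \<inter> space M) \<omega> = measure (cantor_law (p \<omega>)) B"
    if "B \<in> sets cantor" for B
  proof (rule cond_prob_kernel_eqI[OF M F X k _ Int_stable_cylinders _ _ that])
    fix B assume "B \<in> insert {} (range cylinder)"
    then consider "B = {}" | s where "B = cylinder s" by blast
    then show "AE \<omega> in M. cond_prob M F (X -` B \<inter> space M) \<omega> = measure (cantor_law (p \<omega>)) B"
    proof cases
      case 1
      have "AE \<omega> in M. real_cond_exp M F (\<lambda>_. 0) \<omega> = 0"
        by (rule real_cond_exp_F_meas) simp_all
      moreover have "(indicator {} :: 'a \<Rightarrow> real) = (\<lambda>_. 0)"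
        by (simp add: fun_eq_iff)
      ultimately show ?thesis
        by (simp add: 1 cond_prob_def)
    next
      case (2 s)
      have m: "measure (cantor_law (p \<omega>)) B = p \<omega> s" for \<omega>
        using p[of \<omega>] emeasure_cantor_law_cylinder[OF p, of \<omega> s] 2
        by (simp add: measure_def cylinder_weights_def)
      from weights show ?thesis
        by eventually_elim (simp add: m, simp add: p_def q_def A_def 2)
    qed
  qed (simp_all add: sets_cantor)
  then show ?thesis
    by (intro bexI[OF _ k]) blast
qed

text \<open>The tower property: a version that is already measurable for the smaller \<open>\<sigma>\<close>-algebra is its own
  conditional expectation.\<close>
lemma cond_prob_subalgebra:
  assumes M: "prob_space M" and F: "subalgebra M F" and H: "subalgebra F H"
    and A: "A \<in> sets M" and g: "g \<in> borel_measurable H"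
    and bd: "\<And>\<omega>. \<omega> \<in> space M \<Longrightarrow> \<bar>g \<omega>\<bar> \<le> 1"
    and ae: "AE \<omega> in M. cond_prob M F A \<omega> = g \<omega>"
  shows "AE \<omega> in M. cond_prob M H A \<omega> = g \<omega>"
proof -
  have HM: "subalgebra M H" using F H by (auto simp: subalgebra_def)
  have "\<forall>Q\<in>sets F. measure M (A \<inter> Q) = (\<integral>\<omega>. indicator Q \<omega> * g \<omega> \<partial>M)"
    using cond_prob_eq_iff[OF M F A measurable_from_subalg[OF H g] bd] ae by blast
  moreover have "sets H \<subseteq> sets F" using H by (simp add: subalgebra_def)
  ultimately have "\<forall>Q\<in>sets H. measure M (A \<inter> Q) = (\<integral>\<omega>. indicator Q \<omega> * g \<omega> \<partial>M)"
    by blast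
  then show ?thesis
    using cond_prob_eq_iff[OF M HM A g bd] by blast
qed

section \<open>Regular conditional probabilities on standard Borel spaces\<close>

lemma space_borel_of [simp]: "space (borel_of T) = topspace T"
  by (auto simp: borel_of_def space_measure_of_conv)

lemma sets_borel_of: "sets (borel_of T) = sigma_sets (topspace T) {U. openin T U}"
  unfolding borel_of_def by (rule sets_measure_of) (auto dest: openin_subset)

lemma openin_borel_of: "openin T U \<Longrightarrow> U \<in> sets (borel_of T)"
  by (simp add: sets_borel_of sigma_sets.Basic)

lemma measurable_into_borel_of:
  assumes "\<And>x. x \<in> space N \<Longrightarrow> \<phi> x \<in> topspace T"
    and "\<And>U. openin T U \<Longrightarrow> \<phi> -` U \<inter> space N \<in> sets N"
  shows "\<phi> \<in> N \<rightarrow>\<^sub>M borel_of T"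
  unfolding borel_of_def using assms
  by (intro measurable_measure_of) (auto dest: openin_subset)

text \<open>Fix a complete metric and a countable base \<open>U\<close>, and encode a point \<open>x\<close> by the set of all \<open>n\<close> with
  \<open>x \<in> U n\<close>. The sets of indices that arise are exactly those that satisfy the countably many
  conditions called \<open>coherent\<close> below: they contain arbitrarily small base sets, are closed under
  passing to a common refinement whose closure is contained in both sets, contain no empty set,
  and are upward closed. Indeed, by completeness the closures of the base sets of a coherent family
  have a common point, the refinement property puts it in the sets themselves, and smallness
  together with upward closure shows that no other base set contains it. So the set of codes is
  Borel, and decoding is measurable because the preimage of an open set is described by countably
  many digits.\<close>
lemma polish_cantor_retract:
  fixes T :: "'x topology"
  assumes T: "polish T" and ne: "topspace T \<noteq> {}"
  shows "\<exists>\<phi> \<psi>. \<phi> \<in> borel_of T \<rightarrow>\<^sub>M cantor \<and> \<psi> \<in> cantor \<rightarrow>\<^sub>M borel_of T \<and>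
    (\<forall>x\<in>topspace T. \<psi> (\<phi> x) = x)"
proof -
  obtain S :: "'x set" and d where "Metric_space S d" and complete: "Metric_space.mcomplete S d"
    and T_eq: "T = Metric_space.mtopology S d"
    using T unfolding polish_def completely_metrizable_space_def by blast
  interpret Metric_space S d by fact
  have top: "topspace T = S" by (simp add: T_eq)
  obtain \<B> where \<B>: "countable \<B>" "\<forall>V\<in>\<B>. openin T V"
      "\<forall>W x. openin T W \<and> x \<in> W \<longrightarrow> (\<exists>V\<in>\<B>. x \<in> V \<and> V \<subseteq> W)"
    using T unfolding polish_def second_countable_def by blast
  define U where "U = from_nat_into (insert {} \<B>)"
  have range_U: "range U = insert {} \<B>"
    unfolding U_def using \<B>(1) by (intro range_from_nat_into) auto
  have opU: "openin T (U n)" for n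
    proof -
    have "U n \<in> insert {} \<B>" using range_U by blast
    then show ?thesis using \<B>(2) by auto
  qed
  have baseU: "\<exists>n. x \<in> U n \<and> U n \<subseteq> W" if W: "openin T W" "x \<in> W" for W x
  proof -
    obtain V where V: "V \<in> \<B>" "x \<in> V" "V \<subseteq> W" using \<B>(3) W by blast
    then have "V \<in> range U" using range_U by blast
    then obtain n where "U n = V" by blast
    with V show ?thesis by blast
  qed
  have ball: "\<exists>n. x \<in> U n \<and> U n \<subseteq> mball x e" if "x \<in> S" "0 < e" for x e
    using that by (intro baseU) (simp_all add: T_eq)
  have U_S: "U n \<subseteq> S" for n
    using openin_subset[OF opU] top by blast

  define coherent where "coherent b \<longleftrightarrow>
      (\<forall>k::nat. \<exists>n. b n \<and> (\<exists>a. U n \<subseteq> mcball a (inverse (Suc k)))) \<and>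
      (\<forall>n m. b n \<and> b m \<longrightarrow> (\<exists>l. b l \<and> T closure_of U l \<subseteq> U n \<inter> U m)) \<and>
      (\<forall>n. b n \<longrightarrow> U n \<noteq> {}) \<and>
      (\<forall>n m. b n \<and> U n \<subseteq> U m \<longrightarrow> b m)" for b :: "nat \<Rightarrow> bool"
  define \<phi> where "\<phi> x n \<longleftrightarrow> x \<in> U n" for x n

  \<comment> \<open>The refinements exist because the topology is regular.\<close>
  have coherent_\<phi>: "coherent (\<phi> x)" if x: "x \<in> S" for x
    unfolding coherent_def \<phi>_def
  proof (intro conjI allI impI)
    fix k :: nat
    obtain n where "x \<in> U n" "U n \<subseteq> mball x (inverse (Suc k))"
      using ball[OF x, of "inverse (Suc k)"] by auto
    then show "\<exists>n. x \<in> U n \<and> (\<exists>a. U n \<subseteq> mcball a (inverse (Suc k)))"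
      using mball_subset_mcball by blast
  next
    fix n m assume "x \<in> U n \<and> x \<in> U m"
    then have "openin T (U n \<inter> U m)" "x \<in> U n \<inter> U m"
      using opU by (auto intro: openin_Int)
    then obtain r where r: "0 < r" "mball x r \<subseteq> U n \<inter> U m"
      unfolding T_eq openin_mtopology by blast
    obtain l where l: "x \<in> U l" "U l \<subseteq> mball x (r / 2)"
      using ball[OF x, of "r / 2"] r by auto
    have "T closure_of U l \<subseteq> mcball x (r / 2)"
      using l(2) mball_subset_mcball[of x "r / 2"] unfolding T_eq
      by (intro closure_of_minimal closedin_mcball) blast
    also have "\<dots> \<subseteq> mball x r"
      using r(1) by (auto simp: mcball_def mball_def)
    finally show "\<exists>l. x \<in> U l \<and> T closure_of U l \<subseteq> U n \<inter> U m"
      using l(1) r(2) by blast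
  qed auto

  have ex_point: "\<exists>x\<in>S. \<forall>n. b n \<longleftrightarrow> x \<in> U n" if b: "coherent b" for b
  proof -
    have small: "\<exists>n. b n \<and> (\<exists>a. U n \<subseteq> mcball a e)" if e: "0 < e" for e
    proof -
      obtain k where k: "inverse (Suc k) < e"
        using reals_Archimedean[OF e] by auto
      then have "mcball a (inverse (Suc k)) \<subseteq> mcball a e" for a
        by (intro mcball_subset_concentric) simp
      with b show ?thesis unfolding coherent_def by (meson subset_trans)
    qed
    have refine: "\<exists>l. b l \<and> T closure_of U l \<subseteq> U n \<inter> U m" if "b n" "b m" for n m
      using b that unfolding coherent_def by blast
    have nonempty: "U n \<noteq> {}" if "b n" for n
      using b that unfolding coherent_def by blast
    have upward: "b m" if "b n" "U n \<subseteq> U m" for n m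
      using b that unfolding coherent_def by blast
    have cl: "U n \<subseteq> T closure_of U n" for n
      using U_S top by (intro closure_of_subset) simp
    have lower: "\<exists>l. b l \<and> (\<forall>n\<in>F. U l \<subseteq> U n)" if "finite F" "\<forall>n\<in>F. b n" for F
      using that
    proof (induction F)
      case empty
      then show ?case using small[of 1] by auto
    next
      case (insert n F)
      then obtain l where l: "b l" "\<forall>n\<in>F. U l \<subseteq> U n" by auto
      moreover obtain l' where "b l'" "T closure_of U l' \<subseteq> U l \<inter> U n"
        using refine[OF l(1), of n] insert by auto
      ultimately show ?case using cl[of l'] by (intro exI[of _ l']) blast
    qed
    let ?C = "(\<lambda>n. T closure_of U n) ` {n. b n}"
    have "\<Inter> ?C \<noteq> {}"
    proof (rule mcomplete_fip[THEN iffD1, OF complete, rule_format], intro conjI ballI allI impI)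
      show "closedin mtopology C" if "C \<in> ?C" for C
        using that T_eq by auto
      show "\<exists>C a. C \<in> ?C \<and> C \<subseteq> mcball a e" if "0 < e" for e
      proof -
        obtain n a where n: "b n" "U n \<subseteq> mcball a e" using small[OF \<open>0 < e\<close>] by blast
        then have "T closure_of U n \<subseteq> mcball a e"
          unfolding T_eq by (intro closure_of_minimal closedin_mcball)
        with n(1) show ?thesis by blast
      qed
      show "\<Inter> \<F> \<noteq> {}" if \<F>: "finite \<F> \<and> \<F> \<subseteq> ?C" for \<F>
      proof -
        obtain F where F: "F \<subseteq> {n. b n}" "finite F" "\<F> = (\<lambda>n. T closure_of U n) ` F"
          using finite_subset_image[OF conjunct1[OF \<F>] conjunct2[OF \<F>]] by (elim exE conjE)
        then obtain l where l: "b l" "\<forall>n\<in>F. U l \<subseteq> U n" using lower[of F] by blast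
        have "U l \<subseteq> \<Inter> \<F>"
          unfolding F(3) using subset_trans[OF bspec[OF l(2)] cl] by (rule INT_greatest)
        then show ?thesis using nonempty[OF l(1)] by blast
      qed
    qed
    then obtain x where x: "\<And>n. b n \<Longrightarrow> x \<in> T closure_of U n" by blast
    have xU: "x \<in> U n" if "b n" for n
      using refine[OF that that] x by blast
    then have "x \<in> S" using small[of 1] U_S by auto
    moreover have "b m" if m: "x \<in> U m" for m
    proof -
      obtain r where r: "0 < r" "mball x r \<subseteq> U m"
        using m opU[of m] unfolding T_eq openin_mtopology by blast
      obtain n a where n: "b n" "U n \<subseteq> mcball a (r / 3)" using small[of "r / 3"] r by auto
      have "U n \<subseteq> mball x r"
      proof
        fix y assume "y \<in> U n"
        then have "y \<in> mcball a (r / 3)" "x \<in> mcball a (r / 3)" using n(2) xU[OF n(1)] by blast+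
        then have "x \<in> S" "y \<in> S" "a \<in> S" "d a x \<le> r / 3" "d a y \<le> r / 3" by auto
        moreover from this have "d x y \<le> d x a + d a y" "d x a = d a x"
          by (auto intro: triangle commute)
        ultimately show "y \<in> mball x r" using r(1) by auto
      qed
      then show ?thesis using upward[OF n(1), of m] r(2) by blast
    qed
    ultimately show ?thesis using xU by blast
  qed

  have separated: "x = y" if "x \<in> S" "y \<in> S" "\<forall>n. x \<in> U n \<longleftrightarrow> y \<in> U n" for x y
  proof (rule ccontr)
    assume "x \<noteq> y"
    then have "0 < d x y" using that by (simp add: mdist_pos_less)
    then obtain n where "x \<in> U n" "U n \<subseteq> mball x (d x y)" using ball[OF \<open>x \<in> S\<close>] by blast
    then show False using that(3) by auto
  qed

  \<comment> \<open>Sequences that are not codes are sent to an arbitrary point.\<close>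
  obtain x0 where x0: "x0 \<in> S" using ne top by blast
  define pt where "pt b = (SOME x. x \<in> S \<and> (\<forall>n. b n \<longleftrightarrow> x \<in> U n))" for b
  have pt: "pt b \<in> S" "b n \<longleftrightarrow> pt b \<in> U n" if "coherent b" for b n
    using someI_ex[of "\<lambda>x. x \<in> S \<and> (\<forall>n. b n \<longleftrightarrow> x \<in> U n)"] ex_point[OF that]
    unfolding pt_def by blast+
  define \<psi> where "\<psi> b = (if coherent b then pt b else x0)" for b
  have "\<phi> \<in> borel_of T \<rightarrow>\<^sub>M cantor"
  proof (rule measurable_PiM_single'[where f = "\<lambda>n x. \<phi> x n"])
    fix n
    have "U n \<in> sets (borel_of T)" by (rule openin_borel_of[OF opU])
    then show "(\<lambda>x. \<phi> x n) \<in> borel_of T \<rightarrow>\<^sub>M count_space UNIV"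
      unfolding \<phi>_def by measurable
  qed auto
  moreover have "\<psi> \<in> cantor \<rightarrow>\<^sub>M borel_of T"
  proof (rule measurable_into_borel_of)
    fix W assume W: "openin T W"
    have "\<psi> b \<in> W \<longleftrightarrow> (if coherent b then \<exists>n. U n \<subseteq> W \<and> b n else x0 \<in> W)" for b
    proof (cases "coherent b")
      case True
      have "pt b \<in> W \<longleftrightarrow> (\<exists>n. pt b \<in> U n \<and> U n \<subseteq> W)"
        using baseU[OF W] by blast
      then show ?thesis using pt(2)[OF True] True by (auto simp: \<psi>_def)
    qed (simp add: \<psi>_def)
    then have "\<psi> -` W \<inter> space cantor =
        {b \<in> space cantor. if coherent b then \<exists>n. U n \<subseteq> W \<and> b n else x0 \<in> W}"
      by (simp add: vimage_def)
    also have "\<dots> \<in> sets cantor"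
      unfolding coherent_def by measurable
    finally show "\<psi> -` W \<inter> space cantor \<in> sets cantor" .
  qed (simp add: \<psi>_def pt x0 top)
  moreover have "\<forall>x\<in>topspace T. \<psi> (\<phi> x) = x"
  proof
    fix x assume "x \<in> topspace T"
    then have x: "x \<in> S" using top by simp
    have "\<forall>n. \<phi> x n \<longleftrightarrow> pt (\<phi> x) \<in> U n" using pt(2)[OF coherent_\<phi>[OF x]] by blast
    then show "\<psi> (\<phi> x) = x"
      using separated[OF pt(1)[OF coherent_\<phi>[OF x]] x] coherent_\<phi>[OF x]
      by (simp add: \<psi>_def \<phi>_def)
  qed
  ultimately show ?thesis by blast
qed

text \<open>Regular conditional probabilities exist on the Cantor space and are carried over by the
  retraction, which undoes the coding of the values of \<open>X\<close>.\<close>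
lemma ex_kernel_standard_borel:
  assumes M: "prob_space M" and F: "subalgebra M F" and Y: "standard_borel Y" and X: "X \<in> M \<rightarrow>\<^sub>M Y"
  shows "\<exists>k \<in> F \<rightarrow>\<^sub>M prob_algebra Y. \<forall>B\<in>sets Y.
    AE \<omega> in M. cond_prob M F (X -` B \<inter> space M) \<omega> = measure (k \<omega>) B"
proof -
  obtain T where T: "polish T" "topspace T = space Y" "sets (borel_of T) = sets Y"
    using Y unfolding standard_borel_def by blast
  have "topspace T \<noteq> {}"
    using measurable_space[OF X] prob_space.not_empty[OF M] T(2) by auto
  from polish_cantor_retract[OF T(1) this] obtain \<phi> \<psi>
    where \<phi>: "\<phi> \<in> borel_of T \<rightarrow>\<^sub>M cantor" and \<psi>: "\<psi> \<in> cantor \<rightarrow>\<^sub>M borel_of T"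
      and inv: "\<forall>x\<in>topspace T. \<psi> (\<phi> x) = x"
    by blast
  have \<phi>Y: "\<phi> \<in> Y \<rightarrow>\<^sub>M cantor"
    using \<phi> by (simp cong: measurable_cong_sets add: T(3)[symmetric])
  have \<psi>Y: "\<psi> \<in> cantor \<rightarrow>\<^sub>M Y"
    using \<psi> by (subst measurable_cong_sets[OF refl T(3)[symmetric]])
  obtain k where k: "k \<in> F \<rightarrow>\<^sub>M prob_algebra cantor"
    and kB: "\<forall>B\<in>sets cantor. AE \<omega> in M.
      cond_prob M F ((\<lambda>\<omega>. \<phi> (X \<omega>)) -` B \<inter> space M) \<omega> = measure (k \<omega>) B"
    using ex_kernel_cantor[OF M F measurable_compose[OF X \<phi>Y]] by blast
  have k': "(\<lambda>\<omega>. distr (k \<omega>) Y \<psi>) \<in> F \<rightarrow>\<^sub>M prob_algebra Y"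
    by (rule measurable_compose[OF k measurable_distr_prob_space[OF \<psi>Y]])
  have "AE \<omega> in M. cond_prob M F (X -` B \<inter> space M) \<omega> = measure (distr (k \<omega>) Y \<psi>) B"
    if B: "B \<in> sets Y" for B
  proof -
    have eq: "(\<lambda>\<omega>. \<phi> (X \<omega>)) -` (\<psi> -` B \<inter> space cantor) \<inter> space M = X -` B \<inter> space M"
      using measurable_space[OF X] inv T(2) by auto
    have m: "measure (distr (k \<omega>) Y \<psi>) B = measure (k \<omega>) (\<psi> -` B \<inter> space cantor)"
      if "\<omega> \<in> space M" for \<omega>
    proof -
      have "\<omega> \<in> space F" using that F by (simp add: subalgebra_def)
      note kD = prob_kernelD[OF k this]
      have "\<psi> \<in> k \<omega> \<rightarrow>\<^sub>M Y" using \<psi>Y by (subst measurable_cong_sets[OF kD(2) refl])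
      from measure_distr[OF this B] show ?thesis by (simp add: kD(3))
    qed
    have "AE \<omega> in M. cond_prob M F (X -` B \<inter> space M) \<omega> = measure (k \<omega>) (\<psi> -` B \<inter> space cantor)"
      using bspec[OF kB measurable_sets[OF \<psi>Y B]] unfolding eq .
    then show ?thesis
      using AE_space by eventually_elim (simp add: m)
  qed
  then show ?thesis by (intro bexI[OF _ k']) blast
qed

section \<open>Conditional expectations along a directed family\<close>

locale directed_subalgebras = prob_space M
  for M :: "'w measure" +
  fixes D :: "'i set" and r :: "'i rel" and G :: "'i \<Rightarrow> 'w measure"
  assumes nonempty: "D \<noteq> {}"
    and directed: "\<And>I J. I \<in> D \<Longrightarrow> J \<in> D \<Longrightarrow> \<exists>K\<in>D. (I, K) \<in> r \<and> (J, K) \<in> r"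
    and subalg: "\<And>J. J \<in> D \<Longrightarrow> subalgebra M (G J)"
    and mono: "\<And>I J. I \<in> D \<Longrightarrow> J \<in> D \<Longrightarrow> (I, J) \<in> r \<Longrightarrow> sets (G I) \<subseteq> sets (G J)"
begin

definition join :: "'w measure" where
  "join = sigma (space M) (\<Union>J\<in>D. sets (G J))"

text \<open>Approximability in the mean by variables that are measurable at some finite stage. It plays the
  part of the martingale convergence theorem: instead of a limit along a cofinal sequence, only the
  density of the finite stages in the space of integrable variables of the join is used.\<close>
definition L1_approx :: "('w \<Rightarrow> real) \<Rightarrow> bool" where
  "L1_approx Y \<longleftrightarrow> integrable M Y \<and> (\<forall>\<epsilon>>0. \<exists>J\<in>D. \<exists>Y'\<in>borel_measurable (G J).
     integrable M Y' \<and> (\<integral>\<omega>. \<bar>Y \<omega> - Y' \<omega>\<bar> \<partial>M) < \<epsilon>)"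

lemma generator_Pow: "(\<Union>J\<in>D. sets (G J)) \<subseteq> Pow (space M)"
  using subalg sets.sets_into_space by (fastforce simp: subalgebra_def)

lemma sets_join: "sets join = sigma_sets (space M) (\<Union>J\<in>D. sets (G J))"
  unfolding join_def by (rule sets_measure_of[OF generator_Pow])

lemma sets_le_join: "J \<in> D \<Longrightarrow> sets (G J) \<subseteq> sets join"
  unfolding sets_join by (blast intro: sigma_sets.Basic)

lemma subalg_join: "subalgebra M join"
proof -
  have "(\<Union>J\<in>D. sets (G J)) \<subseteq> sets M"
    using subalg by (auto simp: subalgebra_def)
  then have "sets join \<subseteq> sets M"
    unfolding sets_join by (rule sets.sigma_sets_subset)
  then show ?thesis
    by (simp add: subalgebra_def join_def space_measure_of_conv)
qed

lemma Int_stable_generator: "Int_stable (\<Union>J\<in>D. sets (G J))"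
proof (rule Int_stableI)
  fix a b assume "a \<in> (\<Union>J\<in>D. sets (G J))" "b \<in> (\<Union>J\<in>D. sets (G J))"
  then obtain I J where I: "I \<in> D" "a \<in> sets (G I)" and J: "J \<in> D" "b \<in> sets (G J)" by blast
  obtain K where K: "K \<in> D" "(I, K) \<in> r" "(J, K) \<in> r" using directed[OF I(1) J(1)] by blast
  have "a \<in> sets (G K)" "b \<in> sets (G K)"
    using mono[OF I(1) K(1,2)] mono[OF J(1) K(1,3)] I(2) J(2) by blast+
  then have "a \<inter> b \<in> sets (G K)" by (rule sets.Int)
  with K(1) show "a \<inter> b \<in> (\<Union>J\<in>D. sets (G J))" by blast
qed

lemma L1_approxI:
  assumes "J \<in> D" "Y \<in> borel_measurable (G J)" "integrable M Y"
  shows "L1_approx Y"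
  unfolding L1_approx_def using assms by (intro conjI allI impI bexI[of _ J] bexI[of _ Y]) simp_all

lemma L1_approx_cong:
  assumes Y: "L1_approx Y" and eq: "\<And>\<omega>. \<omega> \<in> space M \<Longrightarrow> Y \<omega> = Z \<omega>"
  shows "L1_approx Z"
proof -
  have "(\<integral>\<omega>. \<bar>Z \<omega> - Y' \<omega>\<bar> \<partial>M) = (\<integral>\<omega>. \<bar>Y \<omega> - Y' \<omega>\<bar> \<partial>M)" for Y'
    using eq by (intro Bochner_Integration.integral_cong) simp_all
  moreover have "integrable M Y \<longleftrightarrow> integrable M Z"
    using eq by (intro Bochner_Integration.integrable_cong) simp_all
  ultimately show ?thesis using Y unfolding L1_approx_def by simp
qed

lemma L1_approx_add:
  assumes Y: "L1_approx Y" and Z: "L1_approx Z"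
  shows "L1_approx (\<lambda>\<omega>. Y \<omega> + Z \<omega>)"
  unfolding L1_approx_def
proof (intro conjI allI impI)
  have int: "integrable M Y" "integrable M Z" using Y Z unfolding L1_approx_def by blast+
  then show "integrable M (\<lambda>\<omega>. Y \<omega> + Z \<omega>)" by simp
  fix \<epsilon> :: real assume "0 < \<epsilon>"
  then have e: "0 < \<epsilon> / 2" by simp
  obtain I Y' where I: "I \<in> D" "Y' \<in> borel_measurable (G I)" "integrable M Y'"
      "(\<integral>\<omega>. \<bar>Y \<omega> - Y' \<omega>\<bar> \<partial>M) < \<epsilon> / 2"
    using Y e unfolding L1_approx_def by blast
  obtain J Z' where J: "J \<in> D" "Z' \<in> borel_measurable (G J)" "integrable M Z'"
      "(\<integral>\<omega>. \<bar>Z \<omega> - Z' \<omega>\<bar> \<partial>M) < \<epsilon> / 2"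
    using Z e unfolding L1_approx_def by blast
  obtain K where K: "K \<in> D" "(I, K) \<in> r" "(J, K) \<in> r" using directed[OF I(1) J(1)] by blast
  have sK: "subalgebra (G K) (G I)" "subalgebra (G K) (G J)"
    using subalg[OF I(1)] subalg[OF J(1)] subalg[OF K(1)] mono[OF I(1) K(1,2)] mono[OF J(1) K(1,3)]
    by (simp_all add: subalgebra_def)
  have m: "(\<lambda>\<omega>. Y' \<omega> + Z' \<omega>) \<in> borel_measurable (G K)"
    using measurable_from_subalg[OF sK(1) I(2)] measurable_from_subalg[OF sK(2) J(2)]
    by (rule borel_measurable_add)
  have "(\<integral>\<omega>. \<bar>Y \<omega> + Z \<omega> - (Y' \<omega> + Z' \<omega>)\<bar> \<partial>M) \<le>
      (\<integral>\<omega>. \<bar>Y \<omega> - Y' \<omega>\<bar> + \<bar>Z \<omega> - Z' \<omega>\<bar> \<partial>M)"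
    using int I(3) J(3) by (intro integral_mono) (auto intro!: integrable_abs)
  also have "\<dots> = (\<integral>\<omega>. \<bar>Y \<omega> - Y' \<omega>\<bar> \<partial>M) + (\<integral>\<omega>. \<bar>Z \<omega> - Z' \<omega>\<bar> \<partial>M)"
    using int I(3) J(3) by (intro Bochner_Integration.integral_add integrable_abs) simp_all
  also have "\<dots> < \<epsilon>" using I(4) J(4) by simp
  finally have "(\<integral>\<omega>. \<bar>Y \<omega> + Z \<omega> - (Y' \<omega> + Z' \<omega>)\<bar> \<partial>M) < \<epsilon>" .
  moreover have "integrable M (\<lambda>\<omega>. Y' \<omega> + Z' \<omega>)" using I(3) J(3) by simp
  ultimately show "\<exists>J\<in>D. \<exists>W\<in>borel_measurable (G J).
      integrable M W \<and> (\<integral>\<omega>. \<bar>Y \<omega> + Z \<omega> - W \<omega>\<bar> \<partial>M) < \<epsilon>"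
    using K(1) m by (intro bexI[of _ K] bexI[of _ "\<lambda>\<omega>. Y' \<omega> + Z' \<omega>"]) simp_all
qed

lemma L1_approx_cmult:
  assumes Y: "L1_approx Y"
  shows "L1_approx (\<lambda>\<omega>. c * Y \<omega>)"
  unfolding L1_approx_def
proof (intro conjI allI impI)
  have int: "integrable M Y" using Y unfolding L1_approx_def by blast
  then show "integrable M (\<lambda>\<omega>. c * Y \<omega>)" by simp
  fix \<epsilon> :: real assume e: "0 < \<epsilon>"
  then have "0 < \<epsilon> / (\<bar>c\<bar> + 1)" by (simp add: add_nonneg_pos)
  then obtain J Y' where J: "J \<in> D" "Y' \<in> borel_measurable (G J)" "integrable M Y'"
      "(\<integral>\<omega>. \<bar>Y \<omega> - Y' \<omega>\<bar> \<partial>M) < \<epsilon> / (\<bar>c\<bar> + 1)"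
    using Y unfolding L1_approx_def by blast
  have "(\<integral>\<omega>. \<bar>c * Y \<omega> - c * Y' \<omega>\<bar> \<partial>M) = (\<integral>\<omega>. \<bar>c\<bar> * \<bar>Y \<omega> - Y' \<omega>\<bar> \<partial>M)"
    by (simp add: abs_mult[symmetric] right_diff_distrib)
  also have "\<dots> = \<bar>c\<bar> * (\<integral>\<omega>. \<bar>Y \<omega> - Y' \<omega>\<bar> \<partial>M)"
    by simp
  also have "\<dots> \<le> (\<bar>c\<bar> + 1) * (\<integral>\<omega>. \<bar>Y \<omega> - Y' \<omega>\<bar> \<partial>M)"
    by (intro mult_right_mono Bochner_Integration.integral_nonneg) simp_all
  also have "\<dots> < \<epsilon>"
    using J(4) by (simp add: pos_less_divide_eq add_nonneg_pos mult.commute)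
  finally have "(\<integral>\<omega>. \<bar>c * Y \<omega> - c * Y' \<omega>\<bar> \<partial>M) < \<epsilon>" .
  then show "\<exists>J\<in>D. \<exists>W\<in>borel_measurable (G J).
      integrable M W \<and> (\<integral>\<omega>. \<bar>c * Y \<omega> - W \<omega>\<bar> \<partial>M) < \<epsilon>"
    using J by (intro bexI[of _ J] bexI[of _ "\<lambda>\<omega>. c * Y' \<omega>"]) simp_all
qed

lemma L1_approx_limit:
  assumes Y: "integrable M Y" and s: "\<And>n. L1_approx (s n)"
    and lim: "(\<lambda>n. \<integral>\<omega>. \<bar>Y \<omega> - s n \<omega>\<bar> \<partial>M) \<longlonglongrightarrow> 0"
  shows "L1_approx Y"
  unfolding L1_approx_def
proof (intro conjI allI impI)
  fix \<epsilon> :: real assume "0 < \<epsilon>"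
  then have e: "0 < \<epsilon> / 2" by simp
  have si: "integrable M (s n)" for n using s unfolding L1_approx_def by blast
  obtain n where n: "(\<integral>\<omega>. \<bar>Y \<omega> - s n \<omega>\<bar> \<partial>M) < \<epsilon> / 2"
    using order_tendstoD(2)[OF lim e] by (meson eventually_happens trivial_limit_sequentially)
  obtain J Y' where J: "J \<in> D" "Y' \<in> borel_measurable (G J)" "integrable M Y'"
      "(\<integral>\<omega>. \<bar>s n \<omega> - Y' \<omega>\<bar> \<partial>M) < \<epsilon> / 2"
    using s[of n] e unfolding L1_approx_def by blast
  have "(\<integral>\<omega>. \<bar>Y \<omega> - Y' \<omega>\<bar> \<partial>M) \<le> (\<integral>\<omega>. \<bar>Y \<omega> - s n \<omega>\<bar> + \<bar>s n \<omega> - Y' \<omega>\<bar> \<partial>M)"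
    using Y si J(3) by (intro integral_mono) (auto intro!: integrable_abs)
  also have "\<dots> = (\<integral>\<omega>. \<bar>Y \<omega> - s n \<omega>\<bar> \<partial>M) + (\<integral>\<omega>. \<bar>s n \<omega> - Y' \<omega>\<bar> \<partial>M)"
    using Y si J(3) by (intro Bochner_Integration.integral_add integrable_abs) simp_all
  also have "\<dots> < \<epsilon>" using n J(4) by simp
  finally show "\<exists>J\<in>D. \<exists>W\<in>borel_measurable (G J).
      integrable M W \<and> (\<integral>\<omega>. \<bar>Y \<omega> - W \<omega>\<bar> \<partial>M) < \<epsilon>"
    using J by blast
qed (rule Y)

lemma integrable_indicator_event: "A \<in> sets M \<Longrightarrow> integrable M (indicator A :: _ \<Rightarrow> real)"
  by (simp add: emeasure_eq_measure)

lemma L1_approx_indicator: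
  assumes "A \<in> sets join"
  shows "L1_approx (indicator A)"
proof -
  have M: "A \<in> sets M" if "A \<in> sigma_sets (space M) (\<Union>J\<in>D. sets (G J))" for A
    using that subalg_join unfolding sets_join[symmetric] subalgebra_def by blast
  obtain J0 where J0: "J0 \<in> D" using nonempty by blast
  have "A \<in> sigma_sets (space M) (\<Union>J\<in>D. sets (G J))" using assms by (simp add: sets_join)
  from Int_stable_generator generator_Pow this show ?thesis
  proof (induction rule: sigma_sets_induct_disjoint)
    case (basic A)
    then obtain J where J: "J \<in> D" "A \<in> sets (G J)" by blast
    then have "A \<in> sets M" using subalg[OF J(1)] by (auto simp: subalgebra_def)
    then show ?case
      using J by (intro L1_approxI[OF J(1)] integrable_indicator_event) simp_all
  next
    case empty
    show ?case by (intro L1_approxI[OF J0] integrable_indicator_event) simp_all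
  next
    case (compl A)
    have "space M \<in> sets (G J0)"
      using subalg[OF J0] sets.top[of "G J0"] by (simp add: subalgebra_def)
    then have "L1_approx (indicator (space M))"
      by (intro L1_approxI[OF J0] integrable_indicator_event) simp_all
    from L1_approx_add[OF this L1_approx_cmult[OF compl(2), of "-1"]] show ?case
      by (rule L1_approx_cong) (simp add: indicator_def)
  next
    case (union A)
    note AM = M[OF subsetD[OF union(2) rangeI]]
    define s where "s n \<omega> = (\<Sum>i<n. indicator (A i) \<omega> :: real)" for n :: nat and \<omega>
    have s: "L1_approx (s n)" for n
    proof (induction n)
      case 0
      have "s 0 = indicator {}" by (simp add: s_def fun_eq_iff)
      moreover have "L1_approx (indicator {})"
        by (intro L1_approxI[OF J0] integrable_indicator_event) simp_all
      ultimately show ?case by (simp only:)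
    next
      case (Suc n)
      from L1_approx_add[OF Suc union(3)[of n]] show ?case
        by (rule L1_approx_cong) (simp add: s_def)
    qed
    have UM: "(\<Union>i. A i) \<in> sets M" using AM by blast
    show ?case
    proof (rule L1_approx_limit[OF integrable_indicator_event[OF UM] s])
      have le: "s n \<omega> \<le> indicator (\<Union>i. A i) \<omega>" for n \<omega>
      proof -
        have "s n \<omega> = indicator (\<Union>i<n. A i) \<omega>"
          unfolding s_def using union(1)
          by (intro indicator_UN_disjoint[symmetric]) (auto simp: disjoint_family_on_def)
        also have "\<dots> \<le> indicator (\<Union>i. A i) \<omega>"
          by (auto simp: indicator_def)
        finally show ?thesis .
      qed
      have "(\<integral>\<omega>. \<bar>indicator (\<Union>i. A i) \<omega> - s n \<omega>\<bar> \<partial>M) = prob (\<Union>i. A i) - (\<Sum>i<n. prob (A i))" for n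
      proof -
        have "(\<integral>\<omega>. \<bar>indicator (\<Union>i. A i) \<omega> - s n \<omega>\<bar> \<partial>M) = (\<integral>\<omega>. indicator (\<Union>i. A i) \<omega> - s n \<omega> \<partial>M)"
          using le[of n] by (intro Bochner_Integration.integral_cong) simp_all
        also have "\<dots> = (\<integral>\<omega>. indicator (\<Union>i. A i) \<omega> \<partial>M) - (\<integral>\<omega>. s n \<omega> \<partial>M)"
          using s[of n] UM unfolding L1_approx_def
          by (intro Bochner_Integration.integral_diff integrable_indicator_event) blast+
        also have "(\<integral>\<omega>. s n \<omega> \<partial>M) = (\<Sum>i<n. prob (A i))"
          unfolding s_def using integrable_indicator_event[OF AM] AM
          by (subst Bochner_Integration.integral_sum) simp_all
        finally show ?thesis using UM by simp
      qed
      moreover have "(\<lambda>i. prob (A i)) sums prob (\<Union>i. A i)"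
        using AM union(1) by (intro finite_measure_UNION) blast+
      then have "(\<lambda>n. prob (\<Union>i. A i) - (\<Sum>i<n. prob (A i))) \<longlonglongrightarrow> prob (\<Union>i. A i) - prob (\<Union>i. A i)"
        unfolding sums_def by (intro tendsto_intros)
      ultimately show "(\<lambda>n. \<integral>\<omega>. \<bar>indicator (\<Union>i. A i) \<omega> - s n \<omega>\<bar> \<partial>M) \<longlonglongrightarrow> 0" by simp
    qed
  qed
qed

text \<open>Events of the join are approximable by a Dynkin argument, and approximability is closed under
  linear combinations and limits in the mean.\<close>
lemma L1_approx_join:
  assumes Y: "Y \<in> borel_measurable join" "integrable M Y"
  shows "L1_approx Y"
proof -
  let ?R = "restr_to_subalg M join"
  have space: "space ?R = space M" by (rule space_restr_to_subalg)
  have from_R: "integrable M \<phi>" if "integrable ?R \<phi>" for \<phi> :: "'w \<Rightarrow> real"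
    by (rule integrable_from_subalg[OF subalg_join that])
  have "integrable ?R Y" using Y by (intro integrable_in_subalg[OF subalg_join])
  then show ?thesis
  proof (induct rule: integrable_induct)
    case (base A c)
    then have "A \<in> sets join" by (simp add: sets_restr_to_subalg[OF subalg_join])
    from L1_approx_cmult[OF L1_approx_indicator[OF this], of c] show ?case
      by (simp add: mult.commute)
  next
    case (add f g)
    then show ?case by (intro L1_approx_add)
  next
    case (lim f s)
    show ?case
    proof (rule L1_approx_limit[OF from_R[OF lim(5)] lim(2)])
      have "(\<lambda>n. \<integral>\<omega>. \<bar>f \<omega> - s n \<omega>\<bar> \<partial>M) \<longlonglongrightarrow> (\<integral>\<omega>. 0 \<partial>M)"
      proof (rule integral_dominated_convergence[where w = "\<lambda>\<omega>. 3 * \<bar>f \<omega>\<bar>"])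
        show "(\<lambda>\<omega>. \<bar>f \<omega> - s n \<omega>\<bar>) \<in> borel_measurable M" for n
          using from_R[OF lim(5)] from_R[OF lim(1)] by simp
        show "integrable M (\<lambda>\<omega>. 3 * \<bar>f \<omega>\<bar>)"
          using from_R[OF lim(5)] by simp
        show "AE \<omega> in M. (\<lambda>n. \<bar>f \<omega> - s n \<omega>\<bar>) \<longlonglongrightarrow> 0"
        proof (rule AE_I2)
          fix \<omega> assume "\<omega> \<in> space M"
          then have "(\<lambda>n. s n \<omega>) \<longlonglongrightarrow> f \<omega>" using lim(3) space by simp
          then have "(\<lambda>n. \<bar>f \<omega> - s n \<omega>\<bar>) \<longlonglongrightarrow> \<bar>f \<omega> - f \<omega>\<bar>" by (intro tendsto_intros)
          then show "(\<lambda>n. \<bar>f \<omega> - s n \<omega>\<bar>) \<longlonglongrightarrow> 0" by simp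
        qed
        show "AE \<omega> in M. norm \<bar>f \<omega> - s n \<omega>\<bar> \<le> 3 * \<bar>f \<omega>\<bar>" for n
        proof (rule AE_I2)
          fix \<omega> assume "\<omega> \<in> space M"
          then have "\<bar>s n \<omega>\<bar> \<le> 2 * \<bar>f \<omega>\<bar>" using lim(4)[of \<omega> n] space by simp
          then show "norm \<bar>f \<omega> - s n \<omega>\<bar> \<le> 3 * \<bar>f \<omega>\<bar>" by simp
        qed
      qed simp
      then show "(\<lambda>n. \<integral>\<omega>. \<bar>f \<omega> - s n \<omega>\<bar> \<partial>M) \<longlonglongrightarrow> 0" by simp
    qed
  qed
qed

lemma real_cond_exp_L1_le:
  assumes H: "subalgebra M H" and \<phi>: "integrable M \<phi>"
  shows "(\<integral>\<omega>. \<bar>real_cond_exp M H \<phi> \<omega>\<bar> \<partial>M) \<le> (\<integral>\<omega>. \<bar>\<phi> \<omega>\<bar> \<partial>M)"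
proof -
  interpret H: sigma_finite_subalgebra M H by (rule sigma_finite_subalgebra_of_subalgebra[OF H])
  let ?E = "real_cond_exp M H"
  have a: "integrable M (\<lambda>\<omega>. \<bar>\<phi> \<omega>\<bar>)" using \<phi> by (rule integrable_abs)
  have 1: "AE \<omega> in M. ?E \<phi> \<omega> \<le> ?E (\<lambda>\<omega>. \<bar>\<phi> \<omega>\<bar>) \<omega>"
    by (rule H.real_cond_exp_mono[OF _ \<phi> a]) simp
  have 2: "AE \<omega> in M. ?E (\<lambda>\<omega>. - \<bar>\<phi> \<omega>\<bar>) \<omega> \<le> ?E \<phi> \<omega>"
    using a by (intro H.real_cond_exp_mono[OF _ _ \<phi>]) simp_all
  have 3: "AE \<omega> in M. ?E (\<lambda>\<omega>. - 1 * \<bar>\<phi> \<omega>\<bar>) \<omega> = - 1 * ?E (\<lambda>\<omega>. \<bar>\<phi> \<omega>\<bar>) \<omega>"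
    by (rule H.real_cond_exp_cmult[OF a])
  have "(\<integral>\<omega>. \<bar>?E \<phi> \<omega>\<bar> \<partial>M) \<le> (\<integral>\<omega>. ?E (\<lambda>\<omega>. \<bar>\<phi> \<omega>\<bar>) \<omega> \<partial>M)"
  proof (rule integral_mono_AE)
    show "AE \<omega> in M. \<bar>?E \<phi> \<omega>\<bar> \<le> ?E (\<lambda>\<omega>. \<bar>\<phi> \<omega>\<bar>) \<omega>"
      using 1 2 3 by eventually_elim simp
  qed (use \<phi> a H.real_cond_exp_int(1) in auto)
  then show ?thesis
    using H.real_cond_exp_int(2)[OF a] by simp
qed

end

text \<open>The events over which \<open>h\<close> and \<open>Y\<close> have the same integral form a Dynkin system; the whole space
  must be among them for complements.\<close>
lemma (in prob_space) real_cond_exp_eqI_generator: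
  assumes H: "subalgebra M H"
    and gen: "sets H = sigma_sets (space M) E" "Int_stable E" "E \<subseteq> Pow (space M)" "space M \<in> E"
    and int: "integrable M h" "integrable M Y" and Y: "Y \<in> borel_measurable H"
    and eq: "\<And>Q. Q \<in> E \<Longrightarrow> (\<integral>\<omega>\<in>Q. h \<omega> \<partial>M) = (\<integral>\<omega>\<in>Q. Y \<omega> \<partial>M)"
  shows "AE \<omega> in M. real_cond_exp M H h \<omega> = Y \<omega>"
proof -
  interpret H: sigma_finite_subalgebra M H
    by (rule sigma_finite_subalgebra_of_subalgebra[OF H])
  have M: "Q \<in> sets M" if "Q \<in> sigma_sets (space M) E" for Q
    using that H gen(1) by (auto simp: subalgebra_def)
  have si: "set_integrable M Q h" "set_integrable M Q Y" if "Q \<in> sets M" for Q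
    unfolding set_integrable_def using integrable_mult_indicator[OF that] int by blast+
  have "(\<integral>\<omega>\<in>Q. h \<omega> \<partial>M) = (\<integral>\<omega>\<in>Q. Y \<omega> \<partial>M)" if Q: "Q \<in> sigma_sets (space M) E" for Q
    using gen(2,3) Q
  proof (induction rule: sigma_sets_induct_disjoint)
    case (basic Q) then show ?case by (rule eq)
  next
    case empty show ?case by (simp add: set_lebesgue_integral_def)
  next
    case (compl Q)
    have "(\<integral>\<omega>\<in>space M - Q. \<phi> \<omega> \<partial>M) = (\<integral>\<omega>\<in>space M. \<phi> \<omega> \<partial>M) - (\<integral>\<omega>\<in>Q. \<phi> \<omega> \<partial>M)"
      if "set_integrable M (space M) \<phi>" "set_integrable M Q \<phi>" for \<phi> :: "'a \<Rightarrow> real"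
    proof -
      have "(\<integral>\<omega>\<in>space M - Q. \<phi> \<omega> \<partial>M) = (\<integral>\<omega>. indicator (space M) \<omega> *\<^sub>R \<phi> \<omega> - indicator Q \<omega> *\<^sub>R \<phi> \<omega> \<partial>M)"
        unfolding set_lebesgue_integral_def using sets.sets_into_space[OF M[OF compl(1)]]
        by (intro Bochner_Integration.integral_cong) (auto simp: indicator_def)
      then show ?thesis
        using that unfolding set_lebesgue_integral_def set_integrable_def by simp
    qed
    note this[OF si(1)[OF sets.top] si(1)[OF M[OF compl(1)]]] this[OF si(2)[OF sets.top] si(2)[OF M[OF compl(1)]]]
    then show ?case
      using compl(2) eq[OF gen(4)] by simp
  next
    case (union A)
    then have A: "A i \<in> sets M" for i using M by blast
    then have U: "(\<Union>i. A i) \<in> sets M" by blast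
    have "(\<integral>\<omega>\<in>(\<Union>i. A i). \<phi> \<omega> \<partial>M) = (\<Sum>i. \<integral>\<omega>\<in>A i. \<phi> \<omega> \<partial>M)"
      if "set_integrable M (\<Union>i. A i) \<phi>" for \<phi> :: "'a \<Rightarrow> real"
      using A union(1) that by (intro lebesgue_integral_countable_add) (auto simp: disjoint_family_on_def)
    then show ?case using si[OF U] union(3) by simp
  qed
  then show ?thesis
    using gen(1) int Y by (intro H.real_cond_exp_charact) auto
qed

text \<open>Let \<open>Y = E[h | join G]\<close>. It suffices that \<open>h\<close> and \<open>Y\<close> have the same integral over an event \<open>Q\<close> of
  some \<open>F J\<^sub>0\<close>, since such events generate the join of \<open>F\<close>. Given \<open>\<epsilon>\<close>, choose \<open>Y'\<close> measurable for
  some \<open>G J'\<close> with \<open>E\<bar>Y - Y'\<bar> < \<epsilon> / 2\<close>, and \<open>J\<close> above \<open>I\<close>, \<open>J\<^sub>0\<close> and \<open>J'\<close>. The conditional expectation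
  \<open>Z = E[h | F J]\<close> is \<open>G J\<close>-measurable by hypothesis, hence \<open>Z = E[h | G J] = E[Y | G J]\<close>. Conditional
  expectation contracts the mean, so \<open>Z\<close> is within \<open>\<epsilon> / 2\<close> of \<open>Y'\<close>, thus within \<open>\<epsilon>\<close> of \<open>Y\<close>. The
  integral of \<open>Z\<close> over \<open>Q\<close> is that of \<open>h\<close>.\<close>
lemma (in directed_subalgebras) real_cond_exp_join_eq:
  assumes F: "directed_subalgebras M D r F"
    and GF: "\<And>J. J \<in> D \<Longrightarrow> sets (G J) \<subseteq> sets (F J)"
    and h: "integrable M h" and I: "I \<in> D"
    and suff: "\<And>J. J \<in> D \<Longrightarrow> (I, J) \<in> r \<Longrightarrow>
      \<exists>W\<in>borel_measurable (G J). AE \<omega> in M. real_cond_exp M (F J) h \<omega> = W \<omega>"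
  shows "AE \<omega> in M. real_cond_exp M (directed_subalgebras.join M D F) h \<omega> = real_cond_exp M join h \<omega>"
proof -
  interpret F: directed_subalgebras M D r F by (rule F)
  interpret GD: sigma_finite_subalgebra M join by (rule sigma_finite_subalgebra_of_subalgebra[OF subalg_join])
  define Y where "Y = real_cond_exp M join h"
  have Y: "integrable M Y" "Y \<in> borel_measurable join"
    unfolding Y_def using h GD.real_cond_exp_int(1) by auto
  have Y_approx: "L1_approx Y" by (rule L1_approx_join[OF Y(2,1)])
  have key: "(\<integral>\<omega>\<in>Q. h \<omega> \<partial>M) = (\<integral>\<omega>\<in>Q. Y \<omega> \<partial>M)" if J0: "J0 \<in> D" and Q: "Q \<in> sets (F J0)" for J0 Q
  proof -
    have close: "\<bar>(\<integral>\<omega>\<in>Q. h \<omega> \<partial>M) - (\<integral>\<omega>\<in>Q. Y \<omega> \<partial>M)\<bar> \<le> \<epsilon>" if "0 < \<epsilon>" for \<epsilon>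
    proof -
      have e: "0 < \<epsilon> / 2" using that by simp
      obtain J' Y' where J': "J' \<in> D" "Y' \<in> borel_measurable (G J')" "integrable M Y'"
        and dist: "(\<integral>\<omega>. \<bar>Y \<omega> - Y' \<omega>\<bar> \<partial>M) < \<epsilon> / 2"
        using Y_approx e unfolding L1_approx_def by blast
      obtain K where K: "K \<in> D" "(J0, K) \<in> r" "(J', K) \<in> r" using directed[OF J0 J'(1)] by blast
      obtain J where J: "J \<in> D" "(I, J) \<in> r" "(K, J) \<in> r" using directed[OF I K(1)] by blast
      have QJ: "Q \<in> sets (F J)"
        using F.mono[OF J0 K(1,2)] F.mono[OF K(1) J(1,3)] Q by blast
      then have QM: "Q \<in> sets M" using F.subalg[OF J(1)] by (auto simp: subalgebra_def)
      have sub: "subalgebra (G J) (G J')" "subalgebra (F J) (G J)" "subalgebra join (G J)"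
        using subalg[OF J'(1)] subalg[OF J(1)] F.subalg[OF J(1)] subalg_join GF[OF J(1)]
          mono[OF J'(1) K(1,3)] mono[OF K(1) J(1,3)] sets_le_join[OF J(1)]
        by (auto simp: subalgebra_def)
      have Y'J: "Y' \<in> borel_measurable (G J)" by (rule measurable_from_subalg[OF sub(1) J'(2)])
      interpret FJ: sigma_finite_subalgebra M "F J" by (rule sigma_finite_subalgebra_of_subalgebra[OF F.subalg[OF J(1)]])
      interpret GJ: sigma_finite_subalgebra M "G J" by (rule sigma_finite_subalgebra_of_subalgebra[OF subalg[OF J(1)]])
      define Z where "Z = real_cond_exp M (F J) h"
      have Z: "integrable M Z" unfolding Z_def by (rule FJ.real_cond_exp_int(1)[OF h])
      obtain W where W: "W \<in> borel_measurable (G J)" "AE \<omega> in M. Z \<omega> = W \<omega>"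
        using suff[OF J(1,2)] unfolding Z_def by blast
      have Wi: "integrable M W"
        using Z W measurable_from_subalg[OF subalg[OF J(1)] W(1)]
        by (subst integrable_cong_AE[where g = Z]) auto
      let ?EG = "real_cond_exp M (G J)"
      have "AE \<omega> in M. ?EG Z \<omega> = ?EG h \<omega>"
        unfolding Z_def by (rule GJ.real_cond_exp_nested_subalg[OF F.subalg[OF J(1)] sub(2) h])
      moreover have "AE \<omega> in M. ?EG Z \<omega> = ?EG W \<omega>"
        using Z Wi by (intro GJ.real_cond_exp_cong[OF W(2)]) auto
      moreover have "AE \<omega> in M. ?EG W \<omega> = W \<omega>"
        by (rule GJ.real_cond_exp_F_meas[OF Wi W(1)])
      moreover have "AE \<omega> in M. ?EG Y \<omega> = ?EG h \<omega>"
        unfolding Y_def by (rule GJ.real_cond_exp_nested_subalg[OF subalg_join sub(3) h])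
      moreover have "AE \<omega> in M. ?EG (\<lambda>\<omega>. Y \<omega> - Y' \<omega>) \<omega> = ?EG Y \<omega> - ?EG Y' \<omega>"
        by (rule GJ.real_cond_exp_diff[OF Y(1) J'(3)])
      moreover have "AE \<omega> in M. ?EG Y' \<omega> = Y' \<omega>"
        by (rule GJ.real_cond_exp_F_meas[OF J'(3) Y'J])
      ultimately have Z_eq: "AE \<omega> in M. Z \<omega> - Y' \<omega> = ?EG (\<lambda>\<omega>. Y \<omega> - Y' \<omega>) \<omega>"
        using W(2) by eventually_elim simp
      have "(\<integral>\<omega>. \<bar>Z \<omega> - Y' \<omega>\<bar> \<partial>M) = (\<integral>\<omega>. \<bar>?EG (\<lambda>\<omega>. Y \<omega> - Y' \<omega>) \<omega>\<bar> \<partial>M)"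
        using Z_eq Z J'(3) GJ.real_cond_exp_int(1)[of "\<lambda>\<omega>. Y \<omega> - Y' \<omega>"] Y(1)
        by (intro integral_cong_AE) (auto elim: eventually_mono)
      also have "\<dots> \<le> (\<integral>\<omega>. \<bar>Y \<omega> - Y' \<omega>\<bar> \<partial>M)"
        using Y(1) J'(3) by (intro real_cond_exp_L1_le subalg[OF J(1)]) simp
      finally have ZY': "(\<integral>\<omega>. \<bar>Z \<omega> - Y' \<omega>\<bar> \<partial>M) < \<epsilon> / 2" using dist by simp
      have "(\<integral>\<omega>\<in>Q. h \<omega> \<partial>M) - (\<integral>\<omega>\<in>Q. Y \<omega> \<partial>M) = (\<integral>\<omega>\<in>Q. Z \<omega> \<partial>M) - (\<integral>\<omega>\<in>Q. Y \<omega> \<partial>M)"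
        unfolding Z_def using FJ.real_cond_exp_intA[OF h QJ] by simp
      also have "\<dots> = (\<integral>\<omega>. indicator Q \<omega> * (Z \<omega> - Y \<omega>) \<partial>M)"
        unfolding set_lebesgue_integral_def
        using integrable_mult_indicator[OF QM Z] integrable_mult_indicator[OF QM Y(1)]
        by (simp add: right_diff_distrib)
      also have "\<bar>\<dots>\<bar> \<le> (\<integral>\<omega>. \<bar>indicator Q \<omega> * (Z \<omega> - Y \<omega>)\<bar> \<partial>M)"
        by (rule integral_abs_bound)
      also have "\<dots> \<le> (\<integral>\<omega>. \<bar>Z \<omega> - Y' \<omega>\<bar> + \<bar>Y \<omega> - Y' \<omega>\<bar> \<partial>M)"
      proof (rule integral_mono)
        show "integrable M (\<lambda>\<omega>. \<bar>indicator Q \<omega> * (Z \<omega> - Y \<omega>)\<bar>)"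
          using integrable_mult_indicator[OF QM, of "\<lambda>\<omega>. Z \<omega> - Y \<omega>"] Z Y(1)
          by (intro integrable_abs) simp
        show "integrable M (\<lambda>\<omega>. \<bar>Z \<omega> - Y' \<omega>\<bar> + \<bar>Y \<omega> - Y' \<omega>\<bar>)"
          using Z Y(1) J'(3) by simp
      qed (auto split: split_indicator)
      also have "\<dots> = (\<integral>\<omega>. \<bar>Z \<omega> - Y' \<omega>\<bar> \<partial>M) + (\<integral>\<omega>. \<bar>Y \<omega> - Y' \<omega>\<bar> \<partial>M)"
        using Z Y(1) J'(3) by (intro Bochner_Integration.integral_add integrable_abs) simp_all
      finally show ?thesis using ZY' dist by simp
    qed
    have "\<bar>(\<integral>\<omega>\<in>Q. h \<omega> \<partial>M) - (\<integral>\<omega>\<in>Q. Y \<omega> \<partial>M)\<bar> \<le> 0"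
      by (rule field_le_epsilon) (simp add: close)
    then show ?thesis by simp
  qed
  have "subalgebra F.join join"
  proof -
    have "(\<Union>J\<in>D. sets (G J)) \<subseteq> sets F.join"
      using GF F.sets_le_join by blast
    then have "sets join \<subseteq> sets F.join"
      using sets.sigma_sets_subset[of "\<Union>J\<in>D. sets (G J)" F.join] F.subalg_join
      by (simp add: sets_join subalgebra_def)
    then show ?thesis using subalg_join F.subalg_join by (simp add: subalgebra_def)
  qed
  moreover have "space M \<in> (\<Union>J\<in>D. sets (F J))"
    using I F.subalg[OF I] sets.top[of "F I"] by (auto simp: subalgebra_def)
  ultimately show ?thesis
    unfolding Y_def[symmetric] using key
    by (intro real_cond_exp_eqI_generator[OF F.subalg_join F.sets_join F.Int_stable_generator
          F.generator_Pow _ h Y(1) measurable_from_subalg[OF _ Y(2)]]) auto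
qed

section \<open>Projective limits of Polish spaces\<close>

lemma continuous_map_measurable:
  assumes "continuous_map T T' f"
  shows "f \<in> borel_of T \<rightarrow>\<^sub>M borel_of T'"
proof (rule measurable_into_borel_of)
  show "f x \<in> topspace T'" if "x \<in> space (borel_of T)" for x
    using continuous_map_image_subset_topspace[OF assms] that by auto
  fix U assume "openin T' U"
  then have "openin T {x \<in> topspace T. f x \<in> U}"
    by (rule openin_continuous_map_preimage[OF assms])
  moreover have "f -` U \<inter> space (borel_of T) = {x \<in> topspace T. f x \<in> U}" by auto
  ultimately show "f -` U \<inter> space (borel_of T) \<in> sets (borel_of T)"
    by (simp add: openin_borel_of)
qed

lemma projective_systemD:
  assumes "projective_system D r T f"
  shows "countable D" "D \<noteq> {}" "\<And>I J. (I, J) \<in> r \<Longrightarrow> I \<in> D \<and> J \<in> D"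
    "\<And>I. I \<in> D \<Longrightarrow> (I, I) \<in> r"
    "\<And>I J. I \<in> D \<Longrightarrow> J \<in> D \<Longrightarrow> \<exists>K\<in>D. (I, K) \<in> r \<and> (J, K) \<in> r"
    "\<And>I. I \<in> D \<Longrightarrow> polish (T I)"
    "\<And>I J. (I, J) \<in> r \<Longrightarrow> continuous_map (T J) (T I) (f J I)"
  using assms
  unfolding projective_system_def countable_directed_def partial_order_on_def preorder_on_def
    refl_on_def
  by blast+

definition coordinate_sets :: "'i set \<Rightarrow> 'i rel \<Rightarrow> ('i \<Rightarrow> 'x topology) \<Rightarrow> ('i \<Rightarrow> 'i \<Rightarrow> 'x \<Rightarrow> 'x) \<Rightarrow>
    ('i \<Rightarrow> 'x) set set" where
  "coordinate_sets D r T f =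
     (\<Union>I\<in>D. {(\<lambda>x. x I) -` B \<inter> proj_lim_set D r T f | B. B \<in> sets (borel_of (T I))})"

lemma coordinate_sets_Pow: "coordinate_sets D r T f \<subseteq> Pow (proj_lim_set D r T f)"
  by (auto simp: coordinate_sets_def)

lemma coordinate_setsI:
  "I \<in> D \<Longrightarrow> B \<in> sets (borel_of (T I)) \<Longrightarrow>
    (\<lambda>x. x I) -` B \<inter> proj_lim_set D r T f \<in> coordinate_sets D r T f"
  by (auto simp: coordinate_sets_def)

lemma coordinate_setsE:
  assumes "A \<in> coordinate_sets D r T f"
  obtains I B where "I \<in> D" "B \<in> sets (borel_of (T I))" "A = (\<lambda>x. x I) -` B \<inter> proj_lim_set D r T f"
  using assms by (auto simp: coordinate_sets_def)

lemma proj_lim_eq: "proj_lim D r T f = sigma (proj_lim_set D r T f) (coordinate_sets D r T f)"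
  by (simp add: proj_lim_def coordinate_sets_def)

lemma space_proj_lim [simp]: "space (proj_lim D r T f) = proj_lim_set D r T f"
  by (simp add: proj_lim_eq space_measure_of_conv)

lemma sets_proj_lim:
  "sets (proj_lim D r T f) = sigma_sets (proj_lim_set D r T f) (coordinate_sets D r T f)"
  unfolding proj_lim_eq by (rule sets_measure_of[OF coordinate_sets_Pow])

lemma proj_lim_set_space: "x \<in> proj_lim_set D r T f \<Longrightarrow> I \<in> D \<Longrightarrow> x I \<in> topspace (T I)"
  by (auto simp: proj_lim_set_def)

lemma measurable_coordinate:
  assumes "I \<in> D"
  shows "(\<lambda>x. x I) \<in> proj_lim D r T f \<rightarrow>\<^sub>M borel_of (T I)"
proof (rule measurableI)
  show "x I \<in> space (borel_of (T I))" if "x \<in> space (proj_lim D r T f)" for x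
    using that assms by (simp add: proj_lim_set_space)
  show "(\<lambda>x. x I) -` B \<inter> space (proj_lim D r T f) \<in> sets (proj_lim D r T f)"
    if "B \<in> sets (borel_of (T I))" for B
    using coordinate_setsI[of I D B T r f, OF assms that] by (simp add: sets_proj_lim sigma_sets.Basic)
qed

text \<open>By directedness two conditions on coordinates \<open>I\<close> and \<open>J\<close> are conditions on one coordinate \<open>K\<close>
  above both.\<close>
lemma Int_stable_coordinate_sets:
  assumes sys: "projective_system D r T f"
  shows "Int_stable (coordinate_sets D r T f)"
proof (rule Int_stableI)
  note sysD = projective_systemD[OF sys]
  let ?L = "proj_lim_set D r T f"
  have lift: "\<exists>C\<in>sets (borel_of (T K)). (\<lambda>x. x I) -` B \<inter> ?L = (\<lambda>x. x K) -` C \<inter> ?L"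
    if IK: "(I, K) \<in> r" and B: "B \<in> sets (borel_of (T I))" for I K B
  proof (rule bexI)
    show "f K I -` B \<inter> space (borel_of (T K)) \<in> sets (borel_of (T K))"
      by (rule measurable_sets[OF continuous_map_measurable[OF sysD(7)[OF IK]] B])
    show "(\<lambda>x. x I) -` B \<inter> ?L = (\<lambda>x. x K) -` (f K I -` B \<inter> space (borel_of (T K))) \<inter> ?L"
    proof (intro set_eqI iffI)
      fix x assume x: "x \<in> (\<lambda>x. x I) -` B \<inter> ?L"
      then have "x I = f K I (x K)" "x K \<in> topspace (T K)"
        using IK sysD(3)[OF IK] proj_lim_set_space[of x D r T f K] by (auto simp: proj_lim_set_def)
      with x show "x \<in> (\<lambda>x. x K) -` (f K I -` B \<inter> space (borel_of (T K))) \<inter> ?L" by simp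
    next
      fix x assume x: "x \<in> (\<lambda>x. x K) -` (f K I -` B \<inter> space (borel_of (T K))) \<inter> ?L"
      then have "x I = f K I (x K)"
        using IK by (auto simp: proj_lim_set_def)
      with x show "x \<in> (\<lambda>x. x I) -` B \<inter> ?L" by simp
    qed
  qed
  fix a b assume a: "a \<in> coordinate_sets D r T f" and b: "b \<in> coordinate_sets D r T f"
  from a obtain I A where I: "I \<in> D" "A \<in> sets (borel_of (T I))" "a = (\<lambda>x. x I) -` A \<inter> ?L"
    by (rule coordinate_setsE)
  from b obtain J B where J: "J \<in> D" "B \<in> sets (borel_of (T J))" "b = (\<lambda>x. x J) -` B \<inter> ?L"
    by (rule coordinate_setsE)
  obtain K where K: "K \<in> D" "(I, K) \<in> r" "(J, K) \<in> r" using sysD(5)[OF I(1) J(1)] by blast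
  obtain A' where A': "A' \<in> sets (borel_of (T K))" "a = (\<lambda>x. x K) -` A' \<inter> ?L"
    using lift[OF K(2) I(2)] I(3) by blast
  obtain B' where B': "B' \<in> sets (borel_of (T K))" "b = (\<lambda>x. x K) -` B' \<inter> ?L"
    using lift[OF K(3) J(2)] J(3) by blast
  have "a \<inter> b = (\<lambda>x. x K) -` (A' \<inter> B') \<inter> ?L" using A' B' by blast
  then show "a \<inter> b \<in> coordinate_sets D r T f"
    using coordinate_setsI[of K D "A' \<inter> B'" T r f, OF K(1) sets.Int[OF A'(1) B'(1)]] by simp
qed

lemma lim_var_in_proj_lim_set:
  assumes sys: "projective_system D r T f"
    and V: "\<And>I. I \<in> D \<Longrightarrow> V I \<omega> \<in> topspace (T I)"
    and compat: "\<And>I J. (I, J) \<in> r \<Longrightarrow> V I \<omega> = f J I (V J \<omega>)"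
  shows "lim_var D V \<omega> \<in> proj_lim_set D r T f"
proof -
  have "lim_var D V \<omega> \<in> (\<Pi>\<^sub>E I\<in>D. topspace (T I))"
    unfolding lim_var_def using V by (rule restrict_PiE_iff[THEN iffD2, OF ballI])
  then show ?thesis
    using compat projective_systemD(3)[OF sys] by (simp add: proj_lim_set_def) (simp add: lim_var_def)
qed

lemma measurable_lim_var:
  assumes sys: "projective_system D r T f"
    and V: "\<And>I. I \<in> D \<Longrightarrow> V I \<in> N \<rightarrow>\<^sub>M borel_of (T I)"
    and compat: "\<And>I J \<omega>. (I, J) \<in> r \<Longrightarrow> \<omega> \<in> space N \<Longrightarrow> V I \<omega> = f J I (V J \<omega>)"
  shows "lim_var D V \<in> N \<rightarrow>\<^sub>M proj_lim D r T f"
  unfolding proj_lim_eq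
proof (rule measurable_measure_of[OF coordinate_sets_Pow])
  have L: "lim_var D V \<omega> \<in> proj_lim_set D r T f" if "\<omega> \<in> space N" for \<omega>
    using measurable_space[OF V that] compat[OF _ that] by (intro lim_var_in_proj_lim_set[OF sys]) simp_all
  then show "lim_var D V \<in> space N \<rightarrow> proj_lim_set D r T f" by blast
  fix A assume "A \<in> coordinate_sets D r T f"
  then obtain I B where I: "I \<in> D" "B \<in> sets (borel_of (T I))"
      "A = (\<lambda>x. x I) -` B \<inter> proj_lim_set D r T f"
    by (rule coordinate_setsE)
  have "lim_var D V -` A \<inter> space N = V I -` B \<inter> space N"
    using L I(1) by (auto simp: I(3)) (simp_all add: lim_var_def)
  then show "lim_var D V -` A \<inter> space N \<in> sets N"
    using measurable_sets[OF V[OF I(1)] I(2)] by simp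
qed

lemma vimage_algebra_lim_var:
  assumes sys: "projective_system D r T f"
    and V: "\<And>I \<omega>. I \<in> D \<Longrightarrow> \<omega> \<in> \<Omega> \<Longrightarrow> V I \<omega> \<in> topspace (T I)"
    and compat: "\<And>I J \<omega>. (I, J) \<in> r \<Longrightarrow> \<omega> \<in> \<Omega> \<Longrightarrow> V I \<omega> = f J I (V J \<omega>)"
  shows "vimage_algebra \<Omega> (lim_var D V) (proj_lim D r T f) =
    sigma \<Omega> (\<Union>I\<in>D. sets (vimage_algebra \<Omega> (V I) (borel_of (T I))))"
proof -
  have L: "lim_var D V \<omega> \<in> proj_lim_set D r T f" if "\<omega> \<in> \<Omega>" for \<omega>
    using V[OF _ that] compat[OF _ that] by (intro lim_var_in_proj_lim_set[OF sys]) simp_all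
  have pre: "lim_var D V -` ((\<lambda>x. x I) -` B \<inter> proj_lim_set D r T f) \<inter> \<Omega> = V I -` B \<inter> \<Omega>"
    if "I \<in> D" for I B
    using L that by (auto simp: lim_var_def)
  have sets_V: "sets (vimage_algebra \<Omega> (V I) (borel_of (T I))) =
      {V I -` B \<inter> \<Omega> | B. B \<in> sets (borel_of (T I))}" if "I \<in> D" for I
    using V[OF that] by (intro sets_vimage_algebra2) simp
  have "{lim_var D V -` A \<inter> \<Omega> | A. A \<in> coordinate_sets D r T f} =
      (\<Union>I\<in>D. {V I -` B \<inter> \<Omega> | B. B \<in> sets (borel_of (T I))})"
  proof (intro set_eqI iffI)
    fix Q assume "Q \<in> {lim_var D V -` A \<inter> \<Omega> | A. A \<in> coordinate_sets D r T f}"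
    then obtain A where A: "Q = lim_var D V -` A \<inter> \<Omega>" "A \<in> coordinate_sets D r T f" by blast
    from A(2) obtain I B where I: "I \<in> D" "B \<in> sets (borel_of (T I))"
        "A = (\<lambda>x. x I) -` B \<inter> proj_lim_set D r T f"
      by (rule coordinate_setsE)
    have "Q = V I -` B \<inter> \<Omega>" unfolding A(1) I(3) by (rule pre[OF I(1)])
    with I show "Q \<in> (\<Union>I\<in>D. {V I -` B \<inter> \<Omega> | B. B \<in> sets (borel_of (T I))})" by blast
  next
    fix Q assume "Q \<in> (\<Union>I\<in>D. {V I -` B \<inter> \<Omega> | B. B \<in> sets (borel_of (T I))})"
    then obtain I B where I: "I \<in> D" "B \<in> sets (borel_of (T I))" "Q = V I -` B \<inter> \<Omega>" by blast
    have "Q = lim_var D V -` ((\<lambda>x. x I) -` B \<inter> proj_lim_set D r T f) \<inter> \<Omega>"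
      unfolding I(3) by (rule pre[OF I(1), symmetric])
    then show "Q \<in> {lim_var D V -` A \<inter> \<Omega> | A. A \<in> coordinate_sets D r T f}"
      using coordinate_setsI[of I D B T r f, OF I(1,2)] by blast
  qed
  also have "\<dots> = (\<Union>I\<in>D. sets (vimage_algebra \<Omega> (V I) (borel_of (T I))))"
    using sets_V by simp
  finally have eq: "{lim_var D V -` A \<inter> \<Omega> | A. A \<in> coordinate_sets D r T f} =
    (\<Union>I\<in>D. sets (vimage_algebra \<Omega> (V I) (borel_of (T I))))" .
  have "lim_var D V \<in> \<Omega> \<rightarrow> proj_lim_set D r T f" using L by blast
  from vimage_algebra_sigma[OF coordinate_sets_Pow this] show ?thesis
    unfolding proj_lim_eq eq .
qed

text \<open>The base sets constrain finitely many coordinates. Their shape is part of the conclusion, since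
  it shows that they belong to the \<open>\<sigma>\<close>-algebra generated by the coordinates.\<close>
lemma countable_product_base:
  assumes D: "countable D" and sc: "\<And>i. i \<in> D \<Longrightarrow> second_countable (T i)"
  obtains \<W> where "countable \<W>"
    and "\<forall>W\<in>\<W>. \<exists>F V. finite F \<and> F \<subseteq> D \<and> (\<forall>i\<in>F. openin (T i) (V i)) \<and>
       W = {x \<in> topspace (product_topology T D). \<forall>i\<in>F. x i \<in> V i}"
    and "\<forall>U x. openin (product_topology T D) U \<and> x \<in> U \<longrightarrow> (\<exists>W\<in>\<W>. x \<in> W \<and> W \<subseteq> U)"
proof -
  have "\<exists>\<B>. countable \<B> \<and> (\<forall>V\<in>\<B>. openin (T i) V) \<and>
      (\<forall>U x. openin (T i) U \<and> x \<in> U \<longrightarrow> (\<exists>V\<in>\<B>. x \<in> V \<and> V \<subseteq> U))" if "i \<in> D" for i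
    using sc[OF that] unfolding second_countable_def .
  then obtain \<B> where \<B>: "\<And>i. i \<in> D \<Longrightarrow> countable (\<B> i)"
      "\<And>i V. i \<in> D \<Longrightarrow> V \<in> \<B> i \<Longrightarrow> openin (T i) V"
      "\<And>i U x. i \<in> D \<Longrightarrow> openin (T i) U \<Longrightarrow> x \<in> U \<Longrightarrow> \<exists>V\<in>\<B> i. x \<in> V \<and> V \<subseteq> U"
    by metis
  let ?P = "product_topology T D"
  define box where "box F V = {x \<in> topspace ?P. \<forall>i\<in>F. x i \<in> V i}" for F and V :: "'a \<Rightarrow> 'b set"
  define \<W> where "\<W> = (\<Union>F\<in>{F. finite F \<and> F \<subseteq> D}. box F ` (\<Pi>\<^sub>E i\<in>F. \<B> i))"
  have 1: "countable \<W>"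
    unfolding \<W>_def
  proof (intro countable_UN countable_image)
    show "countable {F. finite F \<and> F \<subseteq> D}" by (rule countable_Collect_finite_subset[OF D])
    fix F assume F: "F \<in> {F. finite F \<and> F \<subseteq> D}"
    then show "countable (\<Pi>\<^sub>E i\<in>F. \<B> i)" using \<B>(1) by (intro countable_PiE) auto
  qed
  have 2: "\<exists>F V. finite F \<and> F \<subseteq> D \<and> (\<forall>i\<in>F. openin (T i) (V i)) \<and> W = box F V"
    if W: "W \<in> \<W>" for W
  proof -
    obtain F V where F: "finite F" "F \<subseteq> D" and V: "V \<in> (\<Pi>\<^sub>E i\<in>F. \<B> i)" and "W = box F V"
      using W unfolding \<W>_def by auto
    moreover have "\<forall>i\<in>F. openin (T i) (V i)"
      using \<B>(2) F(2) PiE_mem[OF V] by blast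
    ultimately show ?thesis by blast
  qed
  have 3: "\<exists>W\<in>\<W>. x \<in> W \<and> W \<subseteq> U" if U: "openin ?P U" and x: "x \<in> U" for U x
  proof -
    obtain O' where O': "finite {i \<in> D. O' i \<noteq> topspace (T i)}" "\<forall>i\<in>D. openin (T i) (O' i)"
        "x \<in> Pi\<^sub>E D O'" "Pi\<^sub>E D O' \<subseteq> U"
      using U x unfolding openin_product_topology_alt by blast
    define F where "F = {i \<in> D. O' i \<noteq> topspace (T i)}"
    have "\<exists>V\<in>\<B> i. x i \<in> V \<and> V \<subseteq> O' i" if "i \<in> F" for i
      using that O'(2) PiE_mem[OF O'(3)] by (intro \<B>(3)) (auto simp: F_def)
    then obtain V where V: "\<And>i. i \<in> F \<Longrightarrow> V i \<in> \<B> i \<and> x i \<in> V i \<and> V i \<subseteq> O' i" by metis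
    have "box F (restrict V F) \<in> \<W>"
      unfolding \<W>_def
    proof (rule UN_I[of F])
      show "F \<in> {F. finite F \<and> F \<subseteq> D}" using O'(1) by (auto simp: F_def)
      have "restrict V F \<in> (\<Pi>\<^sub>E i\<in>F. \<B> i)" using V by (simp add: restrict_PiE_iff)
      then show "box F (restrict V F) \<in> box F ` (\<Pi>\<^sub>E i\<in>F. \<B> i)" by (rule imageI)
    qed
    moreover have "x \<in> box F (restrict V F)"
      using V U x openin_subset[OF U] by (auto simp: box_def)
    moreover have "box F (restrict V F) \<subseteq> Pi\<^sub>E D O'"
    proof
      fix y assume y: "y \<in> box F (restrict V F)"
      have "y i \<in> O' i" if "i \<in> D" for i
      proof (cases "i \<in> F")
        case True
        then show ?thesis using y V[OF True] by (auto simp: box_def)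
      next
        case False
        then have "O' i = topspace (T i)" using that by (simp add: F_def)
        then show ?thesis using y that by (auto simp: box_def)
      qed
      moreover have "y \<in> extensional D" using y by (auto simp: box_def PiE_def)
      ultimately show "y \<in> Pi\<^sub>E D O'" by (auto simp: PiE_def)
    qed
    ultimately show ?thesis
      using O'(4) by (intro bexI[of _ "box F (restrict V F)"] conjI) (assumption | erule (1) subset_trans)+
  qed
  show thesis
    using 2 3 unfolding box_def by (intro that[OF 1] ballI allI impI) (simp_all only: conj_imp_eq_imp_imp)
qed

text \<open>The projective limit is a closed subspace of a countable product of Polish spaces, because the
  connecting maps are continuous into Hausdorff spaces. Its open sets are countable unions of base
  sets, so its Borel sets are those generated by the coordinates.\<close>
lemma standard_borel_proj_lim:
  assumes sys: "projective_system D r T f"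
  shows "standard_borel (proj_lim D r T f)"
proof -
  note sysD = projective_systemD[OF sys]
  let ?P = "product_topology T D" and ?L = "proj_lim_set D r T f"
  let ?R = "subtopology ?P ?L"
  have L_top: "?L \<subseteq> topspace ?P" by (auto simp: proj_lim_set_def)
  then have topR: "topspace ?R = ?L" by (simp add: topspace_subtopology Int_absorb1)
  have cm: "completely_metrizable_space (T I)" and sc: "second_countable (T I)" if "I \<in> D" for I
    using sysD(6)[OF that] by (simp_all add: polish_def)
  obtain \<W> where \<W>: "countable \<W>"
    "\<forall>W\<in>\<W>. \<exists>F V. finite F \<and> F \<subseteq> D \<and> (\<forall>i\<in>F. openin (T i) (V i)) \<and>
       W = {x \<in> topspace ?P. \<forall>i\<in>F. x i \<in> V i}"
    "\<forall>U x. openin ?P U \<and> x \<in> U \<longrightarrow> (\<exists>W\<in>\<W>. x \<in> W \<and> W \<subseteq> U)"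
    by (rule countable_product_base[of D T, OF sysD(1) sc]) (assumption | rule that)+
  have coord: "continuous_map ?P (T I) (\<lambda>x. x I)" if "I \<in> D" for I
    using that by simp
  have "openin ?P W" if "W \<in> \<W>" for W
  proof -
    obtain F V where F: "finite F" "F \<subseteq> D" "\<forall>i\<in>F. openin (T i) (V i)"
        "W = {x \<in> topspace ?P. \<forall>i\<in>F. x i \<in> V i}"
      using bspec[OF \<W>(2) \<open>W \<in> \<W>\<close>] by blast
    have "openin ?P {x \<in> topspace ?P. x i \<in> V i}" if "i \<in> F" for i
      using F(2,3) that by (intro openin_continuous_map_preimage[OF coord]) auto
    note open_i = this
    show ?thesis
    proof (cases "F = {}")
      case True
      then have "W = topspace ?P" unfolding F(4) by simp
      then show ?thesis by (simp only: openin_topspace)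
    next
      case False
      then have "openin ?P (\<Inter>i\<in>F. {x \<in> topspace ?P. x i \<in> V i})"
        using F(1) open_i by (intro openin_Inter) (simp_all only: finite_imageI image_is_empty, blast+)
      also have "(\<Inter>i\<in>F. {x \<in> topspace ?P. x i \<in> V i}) = W"
        unfolding F(4) using False by blast
      finally show ?thesis .
    qed
  qed
  then have scP: "second_countable ?P"
    unfolding second_countable_def using \<W>(1,3)
    by (intro exI[of _ \<W>] conjI ballI allI impI) simp_all
  have "countable {i \<in> D. \<not> (\<exists>a. topspace (T i) \<subseteq> {a})}"
    by (rule countable_subset[OF _ sysD(1)]) blast
  then have cmP: "completely_metrizable_space ?P"
    using cm unfolding completely_metrizable_space_product_topology by blast
  have closed: "closedin ?P ?L"
  proof -
    have cl: "closedin ?P {x \<in> topspace ?P. x I = f J I (x J)}" if "(I, J) \<in> r" for I J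
    proof (rule closedin_continuous_maps_eq[of "T I"])
      have IJ: "I \<in> D" "J \<in> D" using sysD(3)[OF that] by blast+
      show "Hausdorff_space (T I)"
        by (rule metrizable_imp_Hausdorff_space[OF completely_metrizable_imp_metrizable_space[OF cm[OF IJ(1)]]])
      show "continuous_map ?P (T I) (\<lambda>x. x I)" by (rule coord[OF IJ(1)])
      show "continuous_map ?P (T I) (\<lambda>x. f J I (x J))"
        using continuous_map_compose[OF coord[OF IJ(2)] sysD(7)[OF that]] by (simp add: comp_def)
    qed
    obtain I where "I \<in> D" using sysD(2) by blast
    then have "r \<noteq> {}" using sysD(4) by blast
    then have "closedin ?P (\<Inter>((\<lambda>(I, J). {x \<in> topspace ?P. x I = f J I (x J)}) ` r))"
      using cl by (intro closedin_Inter) auto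
    also have "\<Inter>((\<lambda>(I, J). {x \<in> topspace ?P. x I = f J I (x J)}) ` r) = ?L"
      using \<open>r \<noteq> {}\<close> by (auto simp: proj_lim_set_def)
    finally show ?thesis .
  qed
  have "polish ?R"
    unfolding polish_def
    using completely_metrizable_space_closedin[OF cmP closed] second_countable_subtopology[OF scP] by blast
  moreover have "sets (borel_of ?R) = sets (proj_lim D r T f)"
  proof
    have "(\<lambda>x. x) \<in> proj_lim D r T f \<rightarrow>\<^sub>M borel_of ?R"
    proof (rule measurable_into_borel_of)
      fix U assume "openin ?R U"
      then obtain U' where U': "openin ?P U'" "U = U' \<inter> ?L" unfolding openin_subtopology by blast
      have "U = (\<Union>W\<in>{W\<in>\<W>. W \<subseteq> U'}. W \<inter> ?L)"
      proof (intro set_eqI iffI)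
        fix x assume "x \<in> U"
        then obtain W where "W \<in> \<W>" "x \<in> W" "W \<subseteq> U'" using \<W>(3)[rule_format, of U' x] U' by blast
        with \<open>x \<in> U\<close> U'(2) show "x \<in> (\<Union>W\<in>{W\<in>\<W>. W \<subseteq> U'}. W \<inter> ?L)" by blast
      qed (use U'(2) in blast)
      also have "\<dots> \<in> sets (proj_lim D r T f)"
      proof (rule sets.countable_UN')
        show "countable {W\<in>\<W>. W \<subseteq> U'}" using \<W>(1) by simp
        have "W \<inter> ?L \<in> sets (proj_lim D r T f)" if "W \<in> \<W>" for W
        proof -
          obtain F V where F: "finite F" "F \<subseteq> D" "\<forall>i\<in>F. openin (T i) (V i)"
              "W = {x \<in> topspace ?P. \<forall>i\<in>F. x i \<in> V i}"
            using bspec[OF \<W>(2) \<open>W \<in> \<W>\<close>] by blast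
          have "{x \<in> space (proj_lim D r T f). x i \<in> V i} \<in> sets (proj_lim D r T f)" if "i \<in> F" for i
          proof -
            have "i \<in> D" using F(2) that by blast
            have "(\<lambda>x. x i) -` V i \<inter> space (proj_lim D r T f) \<in> sets (proj_lim D r T f)"
              using F(3) that
              by (intro measurable_sets[OF measurable_coordinate[OF \<open>i \<in> D\<close>]] openin_borel_of) blast
            then show ?thesis by (simp add: vimage_def Int_def conj_commute)
          qed
          then have "{x \<in> space (proj_lim D r T f). \<forall>i\<in>F. x i \<in> V i} \<in> sets (proj_lim D r T f)"
            by (intro sets.sets_Collect_finite_All[OF _ F(1)]) blast
          moreover have "{x \<in> space (proj_lim D r T f). \<forall>i\<in>F. x i \<in> V i} = W \<inter> ?L"
            unfolding F(4) using L_top by auto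
          ultimately show ?thesis by simp
        qed
        then show "(\<lambda>W. W \<inter> ?L) ` {W\<in>\<W>. W \<subseteq> U'} \<subseteq> sets (proj_lim D r T f)" by blast
      qed
      finally have "U \<in> sets (proj_lim D r T f)" .
      then show "(\<lambda>x. x) -` U \<inter> space (proj_lim D r T f) \<in> sets (proj_lim D r T f)"
        by (intro sets.Int sets.top) simp
    qed (simp only: topR space_proj_lim)
    from measurable_sets[OF this] show "sets (borel_of ?R) \<subseteq> sets (proj_lim D r T f)"
      using sets.sets_into_space[of _ "borel_of ?R"] by (fastforce simp: topR Int_absorb2)
    have "coordinate_sets D r T f \<subseteq> sets (borel_of ?R)"
    proof
      fix A assume "A \<in> coordinate_sets D r T f"
      then obtain I B where I: "I \<in> D" "B \<in> sets (borel_of (T I))" "A = (\<lambda>x. x I) -` B \<inter> ?L"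
        by (rule coordinate_setsE)
      have "(\<lambda>x. x I) \<in> borel_of ?R \<rightarrow>\<^sub>M borel_of (T I)"
        by (rule continuous_map_measurable[OF continuous_map_from_subtopology[OF coord[OF I(1)]]])
      from measurable_sets[OF this I(2)] show "A \<in> sets (borel_of ?R)"
        unfolding I(3) by (simp only: space_borel_of topR)
    qed
    then show "sets (proj_lim D r T f) \<subseteq> sets (borel_of ?R)"
      using sets.sigma_sets_subset[of "coordinate_sets D r T f" "borel_of ?R"]
      by (simp only: sets_proj_lim topR space_borel_of)
  qed
  ultimately show ?thesis
    unfolding standard_borel_def using topR by (intro exI[of _ ?R]) simp
qed

section \<open>Sufficiency in projective limit models\<close>

text \<open>The parameter is a measurable function of the limiting empirical measure of the observations.\<close>
lemma parametrized_model_measurable: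
  assumes "parametrized_model M T X L \<Theta> P"
  shows "X \<in> M \<rightarrow>\<^sub>M borel_of T" "\<Theta> \<in> M \<rightarrow>\<^sub>M borel_of L"
proof -
  obtain Xs F \<psi> where exch: "exchangeable M (borel_of T) Xs"
    and ex_n: "\<exists>n. \<forall>\<omega>\<in>space M. X \<omega> = Xs n \<omega>"
    and F: "F \<in> (\<Pi>\<^sub>M i\<in>UNIV. borel_of T) \<rightarrow>\<^sub>M prob_algebra (borel_of T)"
    and bimeasurable: "bimeasurable_onto
      (restrict_space (prob_algebra (borel_of T)) ((\<lambda>\<omega>. F (\<lambda>i. Xs i \<omega>)) ` space M)) (borel_of L) \<psi>"
    and \<Theta>: "\<forall>\<omega>\<in>space M. \<Theta> \<omega> = \<psi> (F (\<lambda>i. Xs i \<omega>))"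
    using assms unfolding parametrized_model_def by blast
  have Xs: "Xs n \<in> M \<rightarrow>\<^sub>M borel_of T" for n
    using exch unfolding exchangeable_def by blast
  obtain n where X: "\<forall>\<omega>\<in>space M. X \<omega> = Xs n \<omega>" using ex_n by blast
  have \<psi>: "\<psi> \<in> restrict_space (prob_algebra (borel_of T)) ((\<lambda>\<omega>. F (\<lambda>i. Xs i \<omega>)) ` space M)
      \<rightarrow>\<^sub>M borel_of L"
    using bimeasurable unfolding bimeasurable_onto_def by blast
  show "X \<in> M \<rightarrow>\<^sub>M borel_of T"
    using Xs[of n] X by (subst measurable_cong[where g = "Xs n"]) auto
  have "(\<lambda>\<omega> i. Xs i \<omega>) \<in> M \<rightarrow>\<^sub>M (\<Pi>\<^sub>M i\<in>UNIV. borel_of T)"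
  proof (rule measurable_PiM_single'[where f = Xs, OF Xs])
    show "(\<lambda>\<omega> i. Xs i \<omega>) \<in> space M \<rightarrow> (\<Pi>\<^sub>E i\<in>UNIV. space (borel_of T))"
      using measurable_space[OF Xs] by auto
  qed
  from measurable_compose[OF this F]
  have "(\<lambda>\<omega>. F (\<lambda>i. Xs i \<omega>)) \<in> M \<rightarrow>\<^sub>M
      restrict_space (prob_algebra (borel_of T)) ((\<lambda>\<omega>. F (\<lambda>i. Xs i \<omega>)) ` space M)"
    by (intro measurable_restrict_space2) auto
  from measurable_compose[OF this \<psi>] show "\<Theta> \<in> M \<rightarrow>\<^sub>M borel_of L"
    using \<Theta> by (subst measurable_cong[where g = "\<lambda>\<omega>. \<psi> (F (\<lambda>i. Xs i \<omega>))"]) auto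
qed

lemma subalgebra_vimage_algebra:
  assumes "V \<in> M \<rightarrow>\<^sub>M N"
  shows "subalgebra M (vimage_algebra (space M) V N)"
proof -
  have "sets (vimage_algebra (space M) V N) = {V -` A \<inter> space M | A. A \<in> sets N}"
    using measurable_space[OF assms] by (intro sets_vimage_algebra2) blast
  then show ?thesis
    using measurable_sets[OF assms] by (auto simp: subalgebra_def)
qed

lemma sets_vimage_algebra_compose_le:
  assumes W: "W \<in> \<Omega> \<rightarrow> space N" and V: "\<And>\<omega>. \<omega> \<in> \<Omega> \<Longrightarrow> V \<omega> = g (W \<omega>)" and g: "g \<in> N \<rightarrow>\<^sub>M N'"
  shows "sets (vimage_algebra \<Omega> V N') \<subseteq> sets (vimage_algebra \<Omega> W N)"
proof -
  have "V \<in> \<Omega> \<rightarrow> space N'"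
    using V funcset_mem[OF W] measurable_space[OF g] by simp
  then have "sets (vimage_algebra \<Omega> V N') = {V -` A \<inter> \<Omega> | A. A \<in> sets N'}"
    by (rule sets_vimage_algebra2)
  moreover have "V -` A \<inter> \<Omega> \<in> sets (vimage_algebra \<Omega> W N)" if "A \<in> sets N'" for A
  proof -
    have "V -` A \<inter> \<Omega> = W -` (g -` A \<inter> space N) \<inter> \<Omega>"
      using V funcset_mem[OF W] by auto
    then show ?thesis
      using in_vimage_algebra[OF measurable_sets[OF g that], of W \<Omega>] by simp
  qed
  ultimately show ?thesis
    by (simp add: subset_iff) metis
qed

lemma
  assumes G: "subalgebra M G" and H: "subalgebra M H"
  shows sets_join_alg: "sets (join_alg M G H) = sigma_sets (space M) (sets G \<union> sets H)"
    and subalgebra_join_alg: "subalgebra M (join_alg M G H)"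
    and subalgebra_join_alg1: "subalgebra (join_alg M G H) G"
    and subalgebra_join_alg2: "subalgebra (join_alg M G H) H"
proof -
  have GH: "sets G \<union> sets H \<subseteq> sets M" using G H by (auto simp: subalgebra_def)
  then show s: "sets (join_alg M G H) = sigma_sets (space M) (sets G \<union> sets H)"
    unfolding join_alg_def using sets.space_closed[of M] by (intro sets_measure_of) blast
  have sp: "space (join_alg M G H) = space M" by (simp add: join_alg_def space_measure_of_conv)
  show "subalgebra M (join_alg M G H)"
    using sets.sigma_sets_subset[OF GH] s sp by (simp add: subalgebra_def)
  have "sets G \<union> sets H \<subseteq> sets (join_alg M G H)"
    unfolding s by (rule sigma_sets_superset_generator)
  then show "subalgebra (join_alg M G H) G" "subalgebra (join_alg M G H) H"
    using G H sp by (simp_all add: subalgebra_def)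
qed

lemma join_alg_le:
  assumes G: "subalgebra M G" and H: "subalgebra M H" and N: "subalgebra M N"
    and "sets G \<subseteq> sets N" "sets H \<subseteq> sets N"
  shows "sets (join_alg M G H) \<subseteq> sets N"
  unfolding sets_join_alg[OF G H] using assms(4,5) N
    sets.sigma_sets_subset[of "sets G \<union> sets H" N] by (simp add: subalgebra_def)

lemma directed_subalgebras_join_alg:
  assumes G: "directed_subalgebras M D r G" and H: "directed_subalgebras M D r H"
  shows "directed_subalgebras M D r (\<lambda>J. join_alg M (H J) (G J))"
    "directed_subalgebras.join M D (\<lambda>J. join_alg M (H J) (G J)) =
      join_alg M (directed_subalgebras.join M D H) (directed_subalgebras.join M D G)"
proof -
  interpret G: directed_subalgebras M D r G by fact
  interpret H: directed_subalgebras M D r H by fact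
  let ?F = "\<lambda>J. join_alg M (H J) (G J)"
  have sF: "subalgebra M (?F J)" if "J \<in> D" for J
    by (rule subalgebra_join_alg[OF H.subalg[OF that] G.subalg[OF that]])
  show F: "directed_subalgebras M D r ?F"
  proof (unfold_locales)
    fix I J assume IJ: "I \<in> D" "J \<in> D" "(I, J) \<in> r"
    have "sets (H J) \<subseteq> sets (?F J)" "sets (G J) \<subseteq> sets (?F J)"
      using subalgebra_join_alg1[OF H.subalg G.subalg, of J] subalgebra_join_alg2[OF H.subalg G.subalg, of J] IJ
      by (simp_all add: subalgebra_def)
    then show "sets (?F I) \<subseteq> sets (?F J)"
      using G.mono[OF IJ] H.mono[OF IJ]
      by (intro join_alg_le H.subalg G.subalg sF IJ(1,2)) auto
  qed (use G.nonempty G.directed sF in blast)+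
  interpret F: directed_subalgebras M D r ?F by fact
  have "sets F.join = sets (join_alg M H.join G.join)"
  proof
    have "sets (?F J) \<subseteq> sets (join_alg M H.join G.join)" if J: "J \<in> D" for J
    proof (intro join_alg_le H.subalg G.subalg J subalgebra_join_alg H.subalg_join G.subalg_join)
      show "sets (H J) \<subseteq> sets (join_alg M H.join G.join)"
        using H.sets_le_join[OF J] subalgebra_join_alg1[OF H.subalg_join G.subalg_join]
        by (auto simp: subalgebra_def)
      show "sets (G J) \<subseteq> sets (join_alg M H.join G.join)"
        using G.sets_le_join[OF J] subalgebra_join_alg2[OF H.subalg_join G.subalg_join]
        by (auto simp: subalgebra_def)
    qed
    then show "sets F.join \<subseteq> sets (join_alg M H.join G.join)"
      unfolding F.sets_join
      using sets.sigma_sets_subset[of "\<Union>J\<in>D. sets (?F J)" "join_alg M H.join G.join"]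
        subalgebra_join_alg[OF H.subalg_join G.subalg_join] by (simp add: subalgebra_def UN_least)
    have le: "sets (directed_subalgebras.join M D K) \<subseteq> sets F.join"
      if K: "directed_subalgebras M D r K" and KF: "\<And>J. J \<in> D \<Longrightarrow> sets (K J) \<subseteq> sets (?F J)" for K
    proof -
      have "(\<Union>J\<in>D. sets (K J)) \<subseteq> sets F.join"
        using KF F.sets_le_join by blast
      then show ?thesis
        unfolding directed_subalgebras.sets_join[OF K]
        using sets.sigma_sets_subset[of "\<Union>J\<in>D. sets (K J)" F.join] F.subalg_join
        by (simp add: subalgebra_def)
    qed
    show "sets (join_alg M H.join G.join) \<subseteq> sets F.join"
    proof (intro join_alg_le H.subalg_join G.subalg_join F.subalg_join)
      show "sets H.join \<subseteq> sets F.join"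
        using subalgebra_join_alg1[OF H.subalg G.subalg] by (intro le H) (simp add: subalgebra_def)
      show "sets G.join \<subseteq> sets F.join"
        using subalgebra_join_alg2[OF H.subalg G.subalg] by (intro le G) (simp add: subalgebra_def)
    qed
  qed
  then show "F.join = join_alg M H.join G.join"
    by (rule measure_eqI) (simp only: F.join_def emeasure_sigma, simp add: join_alg_def emeasure_sigma)
qed

locale projective_variables = prob_space M
  for M :: "'w measure" +
  fixes D :: "'i set" and r :: "'i rel"
    and TX :: "'i \<Rightarrow> 'x topology" and f :: "'i \<Rightarrow> 'i \<Rightarrow> 'x \<Rightarrow> 'x" and X :: "'i \<Rightarrow> 'w \<Rightarrow> 'x"
    and TT :: "'i \<Rightarrow> 't topology" and g :: "'i \<Rightarrow> 'i \<Rightarrow> 't \<Rightarrow> 't" and \<Theta> :: "'i \<Rightarrow> 'w \<Rightarrow> 't"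
  assumes sysX: "projective_system D r TX f" and sysT: "projective_system D r TT g"
    and X: "\<And>I. I \<in> D \<Longrightarrow> X I \<in> M \<rightarrow>\<^sub>M borel_of (TX I)"
    and \<Theta>: "\<And>I. I \<in> D \<Longrightarrow> \<Theta> I \<in> M \<rightarrow>\<^sub>M borel_of (TT I)"
    and X_compat: "\<And>I J \<omega>. (I, J) \<in> r \<Longrightarrow> \<omega> \<in> space M \<Longrightarrow> X I \<omega> = f J I (X J \<omega>)"
    and \<Theta>_compat: "\<And>I J \<omega>. (I, J) \<in> r \<Longrightarrow> \<omega> \<in> space M \<Longrightarrow> \<Theta> I \<omega> = g J I (\<Theta> J \<omega>)"
begin

abbreviation "XD \<equiv> lim_var D X"
abbreviation "\<Theta>D \<equiv> lim_var D \<Theta>"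
abbreviation "PX \<equiv> proj_lim D r TX f"
abbreviation "PT \<equiv> proj_lim D r TT g"

lemma measurable_XD: "XD \<in> M \<rightarrow>\<^sub>M PX"
  by (rule measurable_lim_var[OF sysX X X_compat])

lemma measurable_\<Theta>D: "\<Theta>D \<in> M \<rightarrow>\<^sub>M PT"
  by (rule measurable_lim_var[OF sysT \<Theta> \<Theta>_compat])

lemma XD_vimage_coordinate:
  assumes "I \<in> D"
  shows "XD -` ((\<lambda>x. x I) -` A \<inter> proj_lim_set D r TX f) \<inter> space M = X I -` A \<inter> space M"
  using measurable_space[OF measurable_XD] assms by (auto simp: lim_var_def)

text \<open>The limit \<open>\<sigma>\<close>-algebra makes the parameter irrelevant for the limit observation. For events that
  depend on one coordinate \<open>I\<close>, sufficiency at every \<open>J\<close> above \<open>I\<close> is the hypothesis of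
  \<open>real_cond_exp_join_eq\<close> with \<open>F J\<close> the \<open>\<sigma>\<close>-algebra generated by \<open>\<Theta> J\<close> and \<open>G J\<close>. A regular
  conditional probability of the limit observation carries the identity to all events.\<close>
lemma cond_prob_XD_eq:
  assumes suff: "\<And>I. I \<in> D \<Longrightarrow>
      sufficient_law M (G I) (borel_of (TX I)) (X I) (borel_of (TT I)) (\<Theta> I)"
    and Gmono: "\<And>I J. (I, J) \<in> r \<Longrightarrow> sets (G I) \<subseteq> sets (G J)"
  shows "subalgebra M (sigma (space M) (\<Union>I\<in>D. sets (G I)))"
    and "B \<in> sets PX \<Longrightarrow> AE \<omega> in M.
      cond_prob M (join_alg M (vimage_algebra (space M) \<Theta>D PT)
        (sigma (space M) (\<Union>I\<in>D. sets (G I)))) (XD -` B \<inter> space M) \<omega> =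
      cond_prob M (sigma (space M) (\<Union>I\<in>D. sets (G I))) (XD -` B \<inter> space M) \<omega>"
proof -
  note sysD = projective_systemD[OF sysX]
  define H where "H I = vimage_algebra (space M) (\<Theta> I) (borel_of (TT I))" for I
  interpret G: directed_subalgebras M D r G
    using sysD(2,5) suff Gmono by unfold_locales (auto simp: sufficient_law_def)
  show "subalgebra M (sigma (space M) (\<Union>I\<in>D. sets (G I)))"
    using G.subalg_join unfolding G.join_def .
  interpret H: directed_subalgebras M D r H
  proof unfold_locales
    show "subalgebra M (H J)" if "J \<in> D" for J
      unfolding H_def by (rule subalgebra_vimage_algebra[OF \<Theta>[OF that]])
    show "sets (H I) \<subseteq> sets (H J)" if "I \<in> D" "J \<in> D" "(I, J) \<in> r" for I J
      unfolding H_def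
    proof (rule sets_vimage_algebra_compose_le)
      show "\<Theta> J \<in> space M \<rightarrow> space (borel_of (TT J))"
        using measurable_space[OF \<Theta>[OF that(2)]] by blast
      show "g J I \<in> borel_of (TT J) \<rightarrow>\<^sub>M borel_of (TT I)"
        by (rule continuous_map_measurable[OF projective_systemD(7)[OF sysT that(3)]])
    qed (rule \<Theta>_compat[OF that(3)])
  qed (use sysD(2,5) in blast)+
  have H_join: "H.join = vimage_algebra (space M) (lim_var D \<Theta>) (proj_lim D r TT g)"
    unfolding H.join_def H_def using measurable_space[OF \<Theta>] \<Theta>_compat
    by (intro vimage_algebra_lim_var[OF sysT, symmetric]) simp_all
  define F where "F J = join_alg M (H J) (G J)" for J
  have F: "directed_subalgebras M D r F"
    and F_join: "directed_subalgebras.join M D F = join_alg M H.join G.join"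
    unfolding F_def
    using directed_subalgebras_join_alg[OF G.directed_subalgebras_axioms H.directed_subalgebras_axioms]
    by blast+
  interpret F: directed_subalgebras M D r F by (rule F)
  obtain k where k: "k \<in> G.join \<rightarrow>\<^sub>M prob_algebra (proj_lim D r TX f)"
    and kB: "\<forall>B\<in>sets (proj_lim D r TX f). AE \<omega> in M.
      cond_prob M G.join (lim_var D X -` B \<inter> space M) \<omega> = measure (k \<omega>) B"
    using ex_kernel_standard_borel[OF prob_space_axioms G.subalg_join standard_borel_proj_lim[OF sysX] measurable_XD] by blast
  have sub: "subalgebra F.join G.join"
    unfolding F_join by (rule subalgebra_join_alg2[OF H.subalg_join G.subalg_join])
  have coord: "AE \<omega> in M. cond_prob M F.join (lim_var D X -` C \<inter> space M) \<omega> = measure (k \<omega>) C"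
    if C: "C \<in> coordinate_sets D r TX f" for C
  proof -
    obtain I A where I: "I \<in> D" "A \<in> sets (borel_of (TX I))"
        "C = (\<lambda>x. x I) -` A \<inter> proj_lim_set D r TX f"
      using C by (rule coordinate_setsE)
    have CX: "lim_var D X -` C \<inter> space M = X I -` A \<inter> space M"
      unfolding I(3) by (rule XD_vimage_coordinate[OF I(1)])
    have "AE \<omega> in M. cond_prob M F.join (X I -` A \<inter> space M) \<omega> = cond_prob M G.join (X I -` A \<inter> space M) \<omega>"
      unfolding cond_prob_def
    proof (rule G.real_cond_exp_join_eq[OF F _ _ I(1)])
      show "sets (G J) \<subseteq> sets (F J)" if "J \<in> D" for J
        using subalgebra_join_alg2[OF H.subalg[OF that] G.subalg[OF that]]
        by (simp add: F_def subalgebra_def)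
      show "integrable M (indicator (X I -` A \<inter> space M) :: _ \<Rightarrow> real)"
        by (rule G.integrable_indicator_event[OF measurable_sets[OF X[OF I(1)] I(2)]])
      fix J assume J: "J \<in> D" "(I, J) \<in> r"
      define A' where "A' = f J I -` A \<inter> space (borel_of (TX J))"
      have A': "A' \<in> sets (borel_of (TX J))"
        unfolding A'_def
        by (rule measurable_sets[OF continuous_map_measurable[OF sysD(7)[OF J(2)]] I(2)])
      have A'_eq: "X J -` A' \<inter> space M = X I -` A \<inter> space M"
        unfolding A'_def using measurable_space[OF X[OF J(1)]] X_compat[OF J(2)] by auto
      obtain k' where "\<forall>B\<in>sets (borel_of (TX J)).
          (\<lambda>\<omega>. measure (k' \<omega>) B) \<in> borel_measurable (G J) \<and>
          (AE \<omega> in M. cond_prob M (F J) (X J -` B \<inter> space M) \<omega> = measure (k' \<omega>) B)"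
        using suff[OF J(1)] unfolding sufficient_law_def F_def H_def by blast
      from bspec[OF this A'] have "(\<lambda>\<omega>. measure (k' \<omega>) A') \<in> borel_measurable (G J)"
        "AE \<omega> in M. cond_prob M (F J) (X I -` A \<inter> space M) \<omega> = measure (k' \<omega>) A'"
        unfolding A'_eq by (rule conjunct1, rule conjunct2)
      then show "\<exists>W\<in>borel_measurable (G J). AE \<omega> in M.
          real_cond_exp M (F J) (indicator (X I -` A \<inter> space M)) \<omega> = W \<omega>"
        unfolding cond_prob_def by (intro bexI[of _ "\<lambda>\<omega>. measure (k' \<omega>) A'"])
    qed
    moreover have "C \<in> sets (proj_lim D r TX f)"
      using C by (simp add: sets_proj_lim sigma_sets.Basic)
    from bspec[OF kB this]
    have "AE \<omega> in M. cond_prob M G.join (X I -` A \<inter> space M) \<omega> = measure (k \<omega>) C"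
      unfolding CX .
    ultimately show ?thesis unfolding CX by eventually_elim simp
  qed
  assume B: "B \<in> sets PX"
  have "AE \<omega> in M. cond_prob M F.join (lim_var D X -` B \<inter> space M) \<omega> = measure (k \<omega>) B"
  proof (rule cond_prob_kernel_eqI[OF prob_space_axioms F.subalg_join measurable_XD measurable_from_subalg[OF sub k] _
        Int_stable_coordinate_sets[OF sysX] _ coord B])
    show "sets (proj_lim D r TX f) = sigma_sets (space (proj_lim D r TX f)) (coordinate_sets D r TX f)"
      by (simp add: sets_proj_lim)
    show "coordinate_sets D r TX f \<subseteq> Pow (space (proj_lim D r TX f))"
      using coordinate_sets_Pow by simp
  qed
  then have "AE \<omega> in M. cond_prob M F.join (lim_var D X -` B \<inter> space M) \<omega> =
      cond_prob M G.join (lim_var D X -` B \<inter> space M) \<omega>"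
    using bspec[OF kB B] by eventually_elim simp
  then show "AE \<omega> in M.
      cond_prob M (join_alg M (vimage_algebra (space M) \<Theta>D PT)
        (sigma (space M) (\<Union>I\<in>D. sets (G I)))) (XD -` B \<inter> space M) \<omega> =
      cond_prob M (sigma (space M) (\<Union>I\<in>D. sets (G I))) (XD -` B \<inter> space M) \<omega>"
    unfolding F_join H_join G.join_def .
qed

lemma sufficient_law_XD:
  assumes "\<And>I. I \<in> D \<Longrightarrow>
      sufficient_law M (G I) (borel_of (TX I)) (X I) (borel_of (TT I)) (\<Theta> I)"
    and "\<And>I J. (I, J) \<in> r \<Longrightarrow> sets (G I) \<subseteq> sets (G J)"
  shows "sufficient_law M (sigma (space M) (\<Union>I\<in>D. sets (G I))) PX XD PT \<Theta>D"
proof -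
  let ?G = "sigma (space M) (\<Union>I\<in>D. sets (G I))"
  have sub: "subalgebra M ?G" by (rule cond_prob_XD_eq(1)[OF assms])
  obtain k where k: "k \<in> ?G \<rightarrow>\<^sub>M prob_algebra PX"
    and kB: "\<forall>B\<in>sets PX. AE \<omega> in M. cond_prob M ?G (XD -` B \<inter> space M) \<omega> = measure (k \<omega>) B"
    using ex_kernel_standard_borel[OF prob_space_axioms sub standard_borel_proj_lim[OF sysX] measurable_XD]
    by blast
  show ?thesis
    unfolding sufficient_law_def
  proof (intro conjI bexI[of _ k] ballI sub)
    show "k \<in> M \<rightarrow>\<^sub>M prob_algebra PX" by (rule measurable_from_subalg[OF sub k])
    fix B assume B: "B \<in> sets PX"
    show "(\<lambda>\<omega>. measure (k \<omega>) B) \<in> borel_measurable ?G"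
      by (rule measurable_compose[OF k measurable_measure_prob_algebra[OF B]])
    have "AE \<omega> in M. cond_prob M (join_alg M (vimage_algebra (space M) \<Theta>D PT) ?G) (XD -` B \<inter> space M) \<omega> =
        cond_prob M ?G (XD -` B \<inter> space M) \<omega>"
      by (rule cond_prob_XD_eq(2)[OF assms B])
    then show "AE \<omega> in M. cond_prob M (join_alg M (vimage_algebra (space M) \<Theta>D PT) ?G)
        (XD -` B \<inter> space M) \<omega> = measure (k \<omega>) B"
      using bspec[OF kB B] by eventually_elim simp
  qed
qed

text \<open>On a standard Borel sample space the kernel on the sample space is the regular conditional
  probability of the identity.\<close>
lemma sufficient_XD:
  assumes M: "standard_borel M"
    and suff: "\<And>I. I \<in> D \<Longrightarrow>
      sufficient M (G I) (borel_of (TX I)) (X I) (borel_of (TT I)) (\<Theta> I)"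
    and mono: "\<And>I J. (I, J) \<in> r \<Longrightarrow> sets (G I) \<subseteq> sets (G J)"
  shows "sufficient M (sigma (space M) (\<Union>I\<in>D. sets (G I))) PX XD PT \<Theta>D"
proof -
  let ?G = "sigma (space M) (\<Union>I\<in>D. sets (G I))"
  have law: "sufficient_law M (G I) (borel_of (TX I)) (X I) (borel_of (TT I)) (\<Theta> I)"
    if "I \<in> D" for I
    by (rule sufficient_imp_sufficient_law[OF X[OF that] suff[OF that]])
  have sub: "subalgebra M ?G" by (rule cond_prob_XD_eq(1)[OF law mono])
  obtain k where k: "k \<in> ?G \<rightarrow>\<^sub>M prob_algebra M"
    and kA: "\<forall>A\<in>sets M. AE \<omega> in M.
      cond_prob M ?G ((\<lambda>\<omega>. \<omega>) -` A \<inter> space M) \<omega> = measure (k \<omega>) A"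
    using ex_kernel_standard_borel[OF prob_space_axioms sub M measurable_ident_sets[OF refl]]
    by blast
  show ?thesis
    unfolding sufficient_def
  proof (intro conjI bexI[of _ k] ballI sub)
    show "k \<in> M \<rightarrow>\<^sub>M prob_algebra M" by (rule measurable_from_subalg[OF sub k])
    fix B assume B: "B \<in> sets PX"
    define A where "A = XD -` B \<inter> space M"
    have A: "A \<in> sets M" unfolding A_def by (rule measurable_sets[OF measurable_XD B])
    have id: "(\<lambda>\<omega>. \<omega>) -` A \<inter> space M = A" unfolding A_def by blast
    show "(\<lambda>\<omega>. measure (k \<omega>) (XD -` B \<inter> space M)) \<in> borel_measurable ?G"
      using measurable_compose[OF k measurable_measure_prob_algebra[OF A]] unfolding A_def .
    have "AE \<omega> in M. cond_prob M (join_alg M (vimage_algebra (space M) \<Theta>D PT) ?G) A \<omega> =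
        cond_prob M ?G A \<omega>"
      unfolding A_def by (rule cond_prob_XD_eq(2)[OF law mono B])
    then have "AE \<omega> in M. cond_prob M (join_alg M (vimage_algebra (space M) \<Theta>D PT) ?G) A \<omega> =
        measure (k \<omega>) A"
      using bspec[OF kA A] unfolding id by eventually_elim simp
    then show "AE \<omega> in M. cond_prob M (join_alg M (vimage_algebra (space M) \<Theta>D PT) ?G)
        (XD -` B \<inter> space M) \<omega> = measure (k \<omega>) (XD -` B \<inter> space M)"
      unfolding A_def .
  qed
qed

text \<open>The compositions of the statistics with the observations are compatible variables again, so the
  limit map applied to the limit observation is their limit variable and generates the join of
  their \<open>\<sigma>\<close>-algebras.\<close>
lemma
  assumes sysU: "projective_system D r TU h"
    and S: "\<And>I. I \<in> D \<Longrightarrow> S I \<in> borel_of (TX I) \<rightarrow>\<^sub>M borel_of (TU I)"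
    and S_compat: "\<And>I J x. (I, J) \<in> r \<Longrightarrow> x \<in> topspace (TX J) \<Longrightarrow> h J I (S J x) = S I (f J I x)"
  shows measurable_lim_map: "lim_map D S \<in> PX \<rightarrow>\<^sub>M proj_lim D r TU h"
    and vimage_algebra_lim_map: "vimage_algebra (space M) (lim_map D S \<circ> XD) (proj_lim D r TU h) =
      sigma (space M) (\<Union>I\<in>D. sets (vimage_algebra (space M) (S I \<circ> X I) (borel_of (TU I))))"
    and vimage_algebra_statistic_mono: "(I, J) \<in> r \<Longrightarrow>
      sets (vimage_algebra (space M) (S I \<circ> X I) (borel_of (TU I))) \<subseteq>
      sets (vimage_algebra (space M) (S J \<circ> X J) (borel_of (TU J)))"
proof -
  note sysD = projective_systemD[OF sysX]
  have "lim_map D S = lim_var D (\<lambda>I x. S I (x I))"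
    by (simp add: fun_eq_iff lim_map_def lim_var_def)
  also have "\<dots> \<in> PX \<rightarrow>\<^sub>M proj_lim D r TU h"
  proof (rule measurable_lim_var[OF sysU])
    show "(\<lambda>x. S I (x I)) \<in> PX \<rightarrow>\<^sub>M borel_of (TU I)" if "I \<in> D" for I
      by (rule measurable_compose[OF measurable_coordinate[where T = TX, OF that] S[OF that]])
    show "S I (x I) = h J I (S J (x J))" if IJ: "(I, J) \<in> r" and "x \<in> space PX" for I J x
    proof -
      have x: "x \<in> proj_lim_set D r TX f" using that(2) by simp
      then have "x I = f J I (x J)" using IJ by (auto simp: proj_lim_set_def)
      moreover have "x J \<in> topspace (TX J)" using x sysD(3)[OF IJ] by (blast intro: proj_lim_set_space)
      ultimately show ?thesis using S_compat[OF IJ] by simp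
    qed
  qed
  finally show "lim_map D S \<in> PX \<rightarrow>\<^sub>M proj_lim D r TU h" .
  have X_top: "X I \<omega> \<in> topspace (TX I)" if "I \<in> D" "\<omega> \<in> space M" for I \<omega>
    using measurable_space[OF X[OF that(1)] that(2)] by simp
  have SX: "(S I \<circ> X I) \<omega> \<in> topspace (TU I)" if "I \<in> D" "\<omega> \<in> space M" for I \<omega>
    using measurable_space[OF S[OF that(1)]] X_top[OF that] by simp
  have SX_compat: "(S I \<circ> X I) \<omega> = h J I ((S J \<circ> X J) \<omega>)" if "(I, J) \<in> r" "\<omega> \<in> space M" for I J \<omega>
    using S_compat[OF that(1) X_top] sysD(3)[OF that(1)] X_compat[OF that] that(2) by simp
  have "lim_map D S \<circ> XD = lim_var D (\<lambda>I. S I \<circ> X I)"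
    by (auto simp: fun_eq_iff lim_map_def lim_var_def)
  then show "vimage_algebra (space M) (lim_map D S \<circ> XD) (proj_lim D r TU h) =
      sigma (space M) (\<Union>I\<in>D. sets (vimage_algebra (space M) (S I \<circ> X I) (borel_of (TU I))))"
    using vimage_algebra_lim_var[OF sysU, of "space M" "\<lambda>I. S I \<circ> X I", OF SX SX_compat] by simp
  assume IJ: "(I, J) \<in> r"
  show "sets (vimage_algebra (space M) (S I \<circ> X I) (borel_of (TU I))) \<subseteq>
      sets (vimage_algebra (space M) (S J \<circ> X J) (borel_of (TU J)))"
  proof (rule sets_vimage_algebra_compose_le)
    show "h J I \<in> borel_of (TU J) \<rightarrow>\<^sub>M borel_of (TU I)"
      by (rule continuous_map_measurable[OF projective_systemD(7)[OF sysU IJ]])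
    show "S J \<circ> X J \<in> space M \<rightarrow> space (borel_of (TU J))"
      using SX sysD(3)[OF IJ] by simp
  qed (rule SX_compat[OF IJ])
qed

text \<open>The \<open>\<sigma>\<close>-algebra of one parameter \<open>\<Theta> I\<close> is contained in that of the limit parameter, so the tower
  property applies.\<close>
lemma cond_prob_marginal:
  assumes C: "subalgebra M C" and I: "I \<in> D" and B: "B \<in> sets (borel_of (TX I))"
    and \<phi>: "\<phi> \<in> borel_measurable C" and bd: "\<And>\<omega>. \<omega> \<in> space M \<Longrightarrow> \<bar>\<phi> \<omega>\<bar> \<le> 1"
    and ae: "AE \<omega> in M. cond_prob M (join_alg M (vimage_algebra (space M) \<Theta>D PT) C)
      (X I -` B \<inter> space M) \<omega> = \<phi> \<omega>"
  shows "AE \<omega> in M. cond_prob M (join_alg M (vimage_algebra (space M) (\<Theta> I) (borel_of (TT I))) C)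
      (X I -` B \<inter> space M) \<omega> = \<phi> \<omega>"
proof (rule cond_prob_subalgebra[OF prob_space_axioms _ _ measurable_sets[OF X[OF I] B] _ bd ae])
  let ?HI = "vimage_algebra (space M) (\<Theta> I) (borel_of (TT I))"
  let ?HD = "vimage_algebra (space M) \<Theta>D PT"
  have HI: "subalgebra M ?HI" by (rule subalgebra_vimage_algebra[OF \<Theta>[OF I]])
  have HD: "subalgebra M ?HD" by (rule subalgebra_vimage_algebra[OF measurable_\<Theta>D])
  show FD: "subalgebra M (join_alg M ?HD C)" by (rule subalgebra_join_alg[OF HD C])
  have "sets ?HI \<subseteq> sets ?HD"
  proof (rule sets_vimage_algebra_compose_le[OF _ _ measurable_coordinate[OF I]])
    show "\<Theta>D \<in> space M \<rightarrow> space PT" using measurable_space[OF measurable_\<Theta>D] by blast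
    show "\<Theta> I \<omega> = \<Theta>D \<omega> I" for \<omega> using I by (simp add: lim_var_def)
  qed
  then have "sets (join_alg M ?HI C) \<subseteq> sets (join_alg M ?HD C)"
    using subalgebra_join_alg1[OF HD C] subalgebra_join_alg2[OF HD C]
    by (intro join_alg_le[OF HI C FD]) (auto simp: subalgebra_def)
  then show "subalgebra (join_alg M ?HD C) (join_alg M ?HI C)"
    using FD subalgebra_join_alg[OF HI C] by (simp add: subalgebra_def)
  show "\<phi> \<in> borel_measurable (join_alg M ?HI C)"
    by (rule measurable_from_subalg[OF subalgebra_join_alg2[OF HI C] \<phi>])
qed

lemma sufficient_law_marginal:
  assumes C: "sufficient_law M C PX XD PT \<Theta>D" and I: "I \<in> D"
  shows "sufficient_law M C (borel_of (TX I)) (X I) (borel_of (TT I)) (\<Theta> I)"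
proof -
  obtain k where k: "k \<in> M \<rightarrow>\<^sub>M prob_algebra PX" and sub: "subalgebra M C"
    and kB: "\<forall>B\<in>sets PX. (\<lambda>\<omega>. measure (k \<omega>) B) \<in> borel_measurable C \<and>
      (AE \<omega> in M. cond_prob M (join_alg M (vimage_algebra (space M) \<Theta>D PT) C)
        (XD -` B \<inter> space M) \<omega> = measure (k \<omega>) B)"
    using C unfolding sufficient_law_def by blast
  define k' where "k' \<omega> = distr (k \<omega>) (borel_of (TX I)) (\<lambda>x. x I)" for \<omega>
  have k': "k' \<in> M \<rightarrow>\<^sub>M prob_algebra (borel_of (TX I))"
    unfolding k'_def
    by (rule measurable_compose[OF k measurable_distr_prob_space[OF measurable_coordinate[where T = TX, OF I]]])
  have "(\<lambda>\<omega>. measure (k' \<omega>) B) \<in> borel_measurable C \<and>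
      (AE \<omega> in M. cond_prob M (join_alg M (vimage_algebra (space M) (\<Theta> I) (borel_of (TT I))) C)
        (X I -` B \<inter> space M) \<omega> = measure (k' \<omega>) B)"
    if B: "B \<in> sets (borel_of (TX I))" for B
  proof -
    let ?B = "(\<lambda>x. x I) -` B \<inter> space PX"
    have PB: "?B \<in> sets PX" by (rule measurable_sets[OF measurable_coordinate[where T = TX, OF I] B])
    note kD = prob_kernelD[OF k]
    have eq: "measure (k' \<omega>) B = measure (k \<omega>) ?B" if "\<omega> \<in> space M" for \<omega>
    proof -
      have "(\<lambda>x. x I) \<in> k \<omega> \<rightarrow>\<^sub>M borel_of (TX I)"
        using measurable_coordinate[where T = TX, OF I] by (subst measurable_cong_sets[OF kD(2)[OF that] refl])
      from measure_distr[OF this B] show ?thesis by (simp add: k'_def kD(3)[OF that])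
    qed
    have m: "(\<lambda>\<omega>. measure (k' \<omega>) B) \<in> borel_measurable C"
      using bspec[OF kB PB] eq sub by (subst measurable_cong[OF eq]) (auto simp: subalgebra_def)
    have "AE \<omega> in M. cond_prob M (join_alg M (vimage_algebra (space M) \<Theta>D PT) C)
        (XD -` ?B \<inter> space M) \<omega> = measure (k \<omega>) ?B"
      using bspec[OF kB PB] by (rule conjunct2)
    then have "AE \<omega> in M. cond_prob M (join_alg M (vimage_algebra (space M) \<Theta>D PT) C)
        (X I -` B \<inter> space M) \<omega> = measure (k' \<omega>) B"
      unfolding space_proj_lim XD_vimage_coordinate[OF I]
      using AE_space by eventually_elim (simp add: eq)
    with m show ?thesis
      using prob_space.prob_le_1[OF prob_kernelD(1)[OF k']]
      by (intro conjI cond_prob_marginal[OF sub I B m]) simp_all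
  qed
  then show ?thesis
    unfolding sufficient_law_def by (intro conjI sub bexI[OF _ k']) blast
qed

lemma sufficient_marginal:
  assumes C: "sufficient M C PX XD PT \<Theta>D" and I: "I \<in> D"
  shows "sufficient M C (borel_of (TX I)) (X I) (borel_of (TT I)) (\<Theta> I)"
proof -
  obtain k where k: "k \<in> M \<rightarrow>\<^sub>M prob_algebra M" and sub: "subalgebra M C"
    and kB: "\<forall>B\<in>sets PX. (\<lambda>\<omega>. measure (k \<omega>) (XD -` B \<inter> space M)) \<in> borel_measurable C \<and>
      (AE \<omega> in M. cond_prob M (join_alg M (vimage_algebra (space M) \<Theta>D PT) C)
        (XD -` B \<inter> space M) \<omega> = measure (k \<omega>) (XD -` B \<inter> space M))"
    using C unfolding sufficient_def by blast
  have "(\<lambda>\<omega>. measure (k \<omega>) (X I -` B \<inter> space M)) \<in> borel_measurable C \<and>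
      (AE \<omega> in M. cond_prob M (join_alg M (vimage_algebra (space M) (\<Theta> I) (borel_of (TT I))) C)
        (X I -` B \<inter> space M) \<omega> = measure (k \<omega>) (X I -` B \<inter> space M))"
    if B: "B \<in> sets (borel_of (TX I))" for B
  proof -
    have "(\<lambda>x. x I) -` B \<inter> space PX \<in> sets PX"
      by (rule measurable_sets[OF measurable_coordinate[where T = TX, OF I] B])
    from bspec[OF kB this, unfolded space_proj_lim XD_vimage_coordinate[OF I]]
    show ?thesis
      using prob_space.prob_le_1[OF prob_kernelD(1)[OF k]]
      by (intro conjI cond_prob_marginal[OF sub I B]) simp_all
  qed
  then show ?thesis
    unfolding sufficient_def by (intro conjI sub bexI[OF _ k]) blast
qed

end

theorem theorem2:
  fixes M :: "'w measure"
    and D :: "'i set" and r :: "'i rel"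
    and TX :: "'i \<Rightarrow> 'x topology" and f :: "'i \<Rightarrow> 'i \<Rightarrow> 'x \<Rightarrow> 'x" and X :: "'i \<Rightarrow> 'w \<Rightarrow> 'x"
    and TT :: "'i \<Rightarrow> 't topology" and g :: "'i \<Rightarrow> 'i \<Rightarrow> 't \<Rightarrow> 't" and \<Theta> :: "'i \<Rightarrow> 'w \<Rightarrow> 't"
    and P :: "'i \<Rightarrow> 'w \<Rightarrow> 'x measure" and PD :: "'w \<Rightarrow> ('i \<Rightarrow> 'x) measure"
  assumes "prob_space M"
    and "projective_limit_model M D r TX f X TT g \<Theta> P PD"
  shows
    "(\<forall>G :: 'i \<Rightarrow> 'w measure.
        (\<forall>I\<in>D. sufficient_law M (G I) (borel_of (TX I)) (X I) (borel_of (TT I)) (\<Theta> I)) \<and>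
        (\<forall>I J. (I, J) \<in> r \<longrightarrow> sets (G I) \<subseteq> sets (G J)) \<longrightarrow>
        sufficient_law M (sigma (space M) (\<Union>I\<in>D. sets (G I)))
          (proj_lim D r TX f) (lim_var D X) (proj_lim D r TT g) (lim_var D \<Theta>))
   \<and> (\<forall>(TU :: 'i \<Rightarrow> 'u topology) h S.
        projective_system D r TU h \<and>
        (\<forall>I\<in>D. S I \<in> borel_of (TX I) \<rightarrow>\<^sub>M borel_of (TU I)) \<and>
        (\<forall>I J. (I, J) \<in> r \<longrightarrow> (\<forall>x\<in>topspace (TX J). h J I (S J x) = S I (f J I x))) \<and>
        (\<forall>I\<in>D. sufficient_statistic_law M (borel_of (TX I)) (X I) (borel_of (TT I)) (\<Theta> I)
           (borel_of (TU I)) (S I)) \<longrightarrow>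
        sufficient_statistic_law M
          (proj_lim D r TX f) (lim_var D X) (proj_lim D r TT g) (lim_var D \<Theta>)
          (proj_lim D r TU h) (lim_map D S))
   \<and> (\<forall>C :: 'w measure.
        sufficient_law M C
          (proj_lim D r TX f) (lim_var D X) (proj_lim D r TT g) (lim_var D \<Theta>) \<longrightarrow>
        (\<forall>I\<in>D. sufficient_law M C (borel_of (TX I)) (X I) (borel_of (TT I)) (\<Theta> I)))
   \<and> (standard_borel M \<longrightarrow>
      (\<forall>G :: 'i \<Rightarrow> 'w measure.
        (\<forall>I\<in>D. sufficient M (G I) (borel_of (TX I)) (X I) (borel_of (TT I)) (\<Theta> I)) \<and>
        (\<forall>I J. (I, J) \<in> r \<longrightarrow> sets (G I) \<subseteq> sets (G J)) \<longrightarrow>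
        sufficient M (sigma (space M) (\<Union>I\<in>D. sets (G I)))
          (proj_lim D r TX f) (lim_var D X) (proj_lim D r TT g) (lim_var D \<Theta>)))
   \<and> (standard_borel M \<longrightarrow>
      (\<forall>(TU :: 'i \<Rightarrow> 'u topology) h S.
        projective_system D r TU h \<and>
        (\<forall>I\<in>D. S I \<in> borel_of (TX I) \<rightarrow>\<^sub>M borel_of (TU I)) \<and>
        (\<forall>I J. (I, J) \<in> r \<longrightarrow> (\<forall>x\<in>topspace (TX J). h J I (S J x) = S I (f J I x))) \<and>
        (\<forall>I\<in>D. sufficient_statistic M (borel_of (TX I)) (X I) (borel_of (TT I)) (\<Theta> I)
           (borel_of (TU I)) (S I)) \<longrightarrow>
        sufficient_statistic M
          (proj_lim D r TX f) (lim_var D X) (proj_lim D r TT g) (lim_var D \<Theta>)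
          (proj_lim D r TU h) (lim_map D S)))
   \<and> (\<forall>C :: 'w measure.
        sufficient M C
          (proj_lim D r TX f) (lim_var D X) (proj_lim D r TT g) (lim_var D \<Theta>) \<longrightarrow>
        (\<forall>I\<in>D. sufficient M C (borel_of (TX I)) (X I) (borel_of (TT I)) (\<Theta> I)))"
proof -
  have model: "projective_system D r TX f" "projective_system D r TT g"
    "\<And>I. I \<in> D \<Longrightarrow> parametrized_model M (TX I) (X I) (TT I) (\<Theta> I) (P I)"
    "\<And>I J \<omega>. (I, J) \<in> r \<Longrightarrow> \<omega> \<in> space M \<Longrightarrow> X I \<omega> = f J I (X J \<omega>) \<and> \<Theta> I \<omega> = g J I (\<Theta> J \<omega>)"
    using assms(2) unfolding projective_limit_model_def by blast+
  interpret prob_space M by (rule assms(1))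
  interpret projective_variables M D r TX f X TT g \<Theta>
    using model parametrized_model_measurable[OF model(3)] by unfold_locales simp_all
  have part1: "sufficient_law M (sigma (space M) (\<Union>I\<in>D. sets (G I))) PX XD PT \<Theta>D"
    if "(\<forall>I\<in>D. sufficient_law M (G I) (borel_of (TX I)) (X I) (borel_of (TT I)) (\<Theta> I)) \<and>
      (\<forall>I J. (I, J) \<in> r \<longrightarrow> sets (G I) \<subseteq> sets (G J))" for G :: "'i \<Rightarrow> 'w measure"
    using that by (intro sufficient_law_XD) simp_all
  have part1_standard: "sufficient M (sigma (space M) (\<Union>I\<in>D. sets (G I))) PX XD PT \<Theta>D"
    if "standard_borel M"
      "(\<forall>I\<in>D. sufficient M (G I) (borel_of (TX I)) (X I) (borel_of (TT I)) (\<Theta> I)) \<and>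
      (\<forall>I J. (I, J) \<in> r \<longrightarrow> sets (G I) \<subseteq> sets (G J))" for G :: "'i \<Rightarrow> 'w measure"
    using that by (intro sufficient_XD) simp_all
  have part2: "sufficient_statistic_law M PX XD PT \<Theta>D (proj_lim D r TU h) (lim_map D S)"
    if asm: "projective_system D r TU h \<and>
        (\<forall>I\<in>D. S I \<in> borel_of (TX I) \<rightarrow>\<^sub>M borel_of (TU I)) \<and>
        (\<forall>I J. (I, J) \<in> r \<longrightarrow> (\<forall>x\<in>topspace (TX J). h J I (S J x) = S I (f J I x))) \<and>
        (\<forall>I\<in>D. sufficient_statistic_law M (borel_of (TX I)) (X I) (borel_of (TT I)) (\<Theta> I)
           (borel_of (TU I)) (S I))"
    for TU :: "'i \<Rightarrow> 'u topology" and h S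
  proof -
    have sysU: "projective_system D r TU h"
      and S: "\<And>I. I \<in> D \<Longrightarrow> S I \<in> borel_of (TX I) \<rightarrow>\<^sub>M borel_of (TU I)"
      and S_compat: "\<And>I J x. (I, J) \<in> r \<Longrightarrow> x \<in> topspace (TX J) \<Longrightarrow> h J I (S J x) = S I (f J I x)"
      using asm by blast+
    have eq: "vimage_algebra (space M) (lim_map D S \<circ> XD) (proj_lim D r TU h) =
        sigma (space M) (\<Union>I\<in>D. sets (vimage_algebra (space M) (S I \<circ> X I) (borel_of (TU I))))"
      by (rule vimage_algebra_lim_map[OF sysU S S_compat])
    have "sufficient_law M (vimage_algebra (space M) (lim_map D S \<circ> XD) (proj_lim D r TU h)) PX XD PT \<Theta>D"
      unfolding eq
    proof (rule part1, intro conjI ballI allI impI)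
      show "sufficient_law M (vimage_algebra (space M) (S I \<circ> X I) (borel_of (TU I)))
          (borel_of (TX I)) (X I) (borel_of (TT I)) (\<Theta> I)" if "I \<in> D" for I
        using asm that unfolding sufficient_statistic_law_def by blast
    qed (rule vimage_algebra_statistic_mono[OF sysU S S_compat])
    then show ?thesis
      unfolding sufficient_statistic_law_def
      by (intro conjI standard_borel_proj_lim[OF sysU] measurable_lim_map[OF sysU S S_compat])
  qed
  have part2_standard: "sufficient_statistic M PX XD PT \<Theta>D (proj_lim D r TU h) (lim_map D S)"
    if M: "standard_borel M" and asm: "projective_system D r TU h \<and>
        (\<forall>I\<in>D. S I \<in> borel_of (TX I) \<rightarrow>\<^sub>M borel_of (TU I)) \<and>
        (\<forall>I J. (I, J) \<in> r \<longrightarrow> (\<forall>x\<in>topspace (TX J). h J I (S J x) = S I (f J I x))) \<and>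
        (\<forall>I\<in>D. sufficient_statistic M (borel_of (TX I)) (X I) (borel_of (TT I)) (\<Theta> I)
           (borel_of (TU I)) (S I))"
    for TU :: "'i \<Rightarrow> 'u topology" and h S
  proof -
    have sysU: "projective_system D r TU h"
      and S: "\<And>I. I \<in> D \<Longrightarrow> S I \<in> borel_of (TX I) \<rightarrow>\<^sub>M borel_of (TU I)"
      and S_compat: "\<And>I J x. (I, J) \<in> r \<Longrightarrow> x \<in> topspace (TX J) \<Longrightarrow> h J I (S J x) = S I (f J I x)"
      using asm by blast+
    have eq: "vimage_algebra (space M) (lim_map D S \<circ> XD) (proj_lim D r TU h) =
        sigma (space M) (\<Union>I\<in>D. sets (vimage_algebra (space M) (S I \<circ> X I) (borel_of (TU I))))"
      by (rule vimage_algebra_lim_map[OF sysU S S_compat])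
    have "sufficient M (vimage_algebra (space M) (lim_map D S \<circ> XD) (proj_lim D r TU h)) PX XD PT \<Theta>D"
      unfolding eq
    proof (rule part1_standard[OF M], intro conjI ballI allI impI)
      show "sufficient M (vimage_algebra (space M) (S I \<circ> X I) (borel_of (TU I)))
          (borel_of (TX I)) (X I) (borel_of (TT I)) (\<Theta> I)" if "I \<in> D" for I
        using asm that unfolding sufficient_statistic_def by blast
    qed (rule vimage_algebra_statistic_mono[OF sysU S S_compat])
    then show ?thesis
      unfolding sufficient_statistic_def
      by (intro conjI standard_borel_proj_lim[OF sysU] measurable_lim_map[OF sysU S S_compat])
  qed
  show ?thesis
    by (intro conjI allI impI ballI; (rule part1 part1_standard part2 part2_standard sufficient_law_marginal
          sufficient_marginal; assumption))
qed

end
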